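(* If $G$ is a maximal outerplane graph whose weak-dual is a path, then $\overrightarrow{\chi}(G)\leq 13$.
   Context: An orientation $D$ of a graph $G$ replaces each edge by exactly one of its two possible arcs; $d^-_D(v)$ is the indegree of $v$. $D$ is proper if adjacent vertices have distinct indegrees; a $k$-orientation has maximum indegree at most $k$. $\overrightarrow{\chi}(G)$ is the minimum $k$ such that $G$ admits a proper $k$-orientation. A graph is maximal outerplanar if it is outerplanar and no edge can be added keeping it outerplanar; a maximal outerplane graph is an outerplanar embedding of such a graph (all vertices on the outer face). The weak-dual is the dual graph with the vertex corresponding to the outer face removed. *)

theory Defs
  imports "HOL-Analysis.Analysis"
begin

definition simple_graph :: "'a set \<Rightarrow> 'a set set \<Rightarrow> bool" where
  "simple_graph V E \<longleftrightarrow> finite V \<and> (\<forall>e\<in>E. e \<subseteq> V \<and> card e = 2)"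


subsection \<open>Orientations\<close>

text \<open>The pair \<open>(u, v)\<close> is the arc from \<open>u\<close> to \<open>v\<close>.\<close>

definition orientation :: "'a set set \<Rightarrow> ('a \<times> 'a) set \<Rightarrow> bool" where
  "orientation E D \<longleftrightarrow>
     (\<forall>(u, v)\<in>D. {u, v} \<in> E) \<and>
     (\<forall>u v. {u, v} \<in> E \<longrightarrow> ((u, v) \<in> D \<longleftrightarrow> (v, u) \<notin> D))"

definition indegree :: "('a \<times> 'a) set \<Rightarrow> 'a \<Rightarrow> nat" where
  "indegree D v = card {u. (u, v) \<in> D}"

definition proper_orientation :: "'a set set \<Rightarrow> ('a \<times> 'a) set \<Rightarrow> bool" where
  "proper_orientation E D \<longleftrightarrow>
     orientation E D \<and> (\<forall>u v. {u, v} \<in> E \<longrightarrow> indegree D u \<noteq> indegree D v)"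

definition proper_k_orientation :: "'a set \<Rightarrow> 'a set set \<Rightarrow> nat \<Rightarrow> ('a \<times> 'a) set \<Rightarrow> bool" where
  "proper_k_orientation V E k D \<longleftrightarrow>
     proper_orientation E D \<and> (\<forall>v\<in>V. indegree D v \<le> k)"

definition proper_orientation_number :: "'a set \<Rightarrow> 'a set set \<Rightarrow> nat" where
  "proper_orientation_number V E = (LEAST k. \<exists>D. proper_k_orientation V E k D)"


subsection \<open>Plane embeddings\<close>

text \<open>A drawing places each vertex \<open>v\<close> at the point \<open>p v\<close> and each edge \<open>e\<close>
  along the arc \<open>\<gamma> e\<close>; arcs are arbitrary injective continuous curves.\<close>

definition plane_embedding ::
    "'a set \<Rightarrow> 'a set set \<Rightarrow> ('a \<Rightarrow> complex) \<Rightarrow> ('a set \<Rightarrow> real \<Rightarrow> complex) \<Rightarrow> bool" where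
  "plane_embedding V E p \<gamma> \<longleftrightarrow>
     simple_graph V E \<and> inj_on p V \<and>
     (\<forall>e\<in>E. arc (\<gamma> e) \<and> {pathstart (\<gamma> e), pathfinish (\<gamma> e)} = p ` e \<and>
             path_image (\<gamma> e) \<inter> p ` V = p ` e) \<and>
     (\<forall>e\<in>E. \<forall>f\<in>E. e \<noteq> f \<longrightarrow> path_image (\<gamma> e) \<inter> path_image (\<gamma> f) = p ` (e \<inter> f))"

definition point_set ::
    "'a set \<Rightarrow> 'a set set \<Rightarrow> ('a \<Rightarrow> complex) \<Rightarrow> ('a set \<Rightarrow> real \<Rightarrow> complex) \<Rightarrow> complex set" where
  "point_set V E p \<gamma> = p ` V \<union> (\<Union>e\<in>E. path_image (\<gamma> e))"

definition faces ::
    "'a set \<Rightarrow> 'a set set \<Rightarrow> ('a \<Rightarrow> complex) \<Rightarrow> ('a set \<Rightarrow> real \<Rightarrow> complex) \<Rightarrow> complex set set" where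
  "faces V E p \<gamma> = components (- point_set V E p \<gamma>)"

text \<open>The point set of a finite graph is compact, so its complement has exactly one unbounded
  component, and \<^const>\<open>outside\<close> (the union of the unbounded components) is that component.\<close>

definition outer_face ::
    "'a set \<Rightarrow> 'a set set \<Rightarrow> ('a \<Rightarrow> complex) \<Rightarrow> ('a set \<Rightarrow> real \<Rightarrow> complex) \<Rightarrow> complex set" where
  "outer_face V E p \<gamma> = outside (point_set V E p \<gamma>)"

definition outerplane_embedding ::
    "'a set \<Rightarrow> 'a set set \<Rightarrow> ('a \<Rightarrow> complex) \<Rightarrow> ('a set \<Rightarrow> real \<Rightarrow> complex) \<Rightarrow> bool" where
  "outerplane_embedding V E p \<gamma> \<longleftrightarrow>
     plane_embedding V E p \<gamma> \<and> p ` V \<subseteq> frontier (outer_face V E p \<gamma>)"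

definition outerplanar :: "'a set \<Rightarrow> 'a set set \<Rightarrow> bool" where
  "outerplanar V E \<longleftrightarrow> (\<exists>p \<gamma>. outerplane_embedding V E p \<gamma>)"

definition maximal_outerplanar :: "'a set \<Rightarrow> 'a set set \<Rightarrow> bool" where
  "maximal_outerplanar V E \<longleftrightarrow>
     outerplanar V E \<and>
     (\<forall>u\<in>V. \<forall>v\<in>V. u \<noteq> v \<and> {u, v} \<notin> E \<longrightarrow> \<not> outerplanar V (insert {u, v} E))"

definition maximal_outerplane ::
    "'a set \<Rightarrow> 'a set set \<Rightarrow> ('a \<Rightarrow> complex) \<Rightarrow> ('a set \<Rightarrow> real \<Rightarrow> complex) \<Rightarrow> bool" where
  "maximal_outerplane V E p \<gamma> \<longleftrightarrow>
     maximal_outerplanar V E \<and> outerplane_embedding V E p \<gamma>"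


subsection \<open>Weak dual\<close>

text \<open>The dual is a multigraph: its vertices are the faces, and each edge \<open>e\<close> of the graph is
  also an edge of the dual, joining the faces that have \<open>e\<close> on their boundary. A single such
  face makes \<open>e\<close> a loop; two edges with the same ends are parallel. Removing the outer face
  removes every edge incident with it.\<close>

definition dual_ends ::
    "'a set \<Rightarrow> 'a set set \<Rightarrow> ('a \<Rightarrow> complex) \<Rightarrow> ('a set \<Rightarrow> real \<Rightarrow> complex) \<Rightarrow>
     'a set \<Rightarrow> complex set set" where
  "dual_ends V E p \<gamma> e = {F \<in> faces V E p \<gamma>. path_image (\<gamma> e) \<subseteq> frontier F}"

definition weak_dual_vertices ::
    "'a set \<Rightarrow> 'a set set \<Rightarrow> ('a \<Rightarrow> complex) \<Rightarrow> ('a set \<Rightarrow> real \<Rightarrow> complex) \<Rightarrow> complex set set" where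
  "weak_dual_vertices V E p \<gamma> = faces V E p \<gamma> - {outer_face V E p \<gamma>}"

definition weak_dual_edges ::
    "'a set \<Rightarrow> 'a set set \<Rightarrow> ('a \<Rightarrow> complex) \<Rightarrow> ('a set \<Rightarrow> real \<Rightarrow> complex) \<Rightarrow> 'a set set" where
  "weak_dual_edges V E p \<gamma> = {e \<in> E. outer_face V E p \<gamma> \<notin> dual_ends V E p \<gamma> e}"

text \<open>A multigraph with vertex set \<open>W\<close>, edge set \<open>X\<close> and end map \<open>ends\<close> is a path; a path has at
  least one vertex. Injectivity of \<open>ends\<close> on \<open>X\<close> excludes parallel edges, and distinctness of the
  vertex list excludes loops.\<close>

definition is_path_graph :: "'v set \<Rightarrow> 'e set \<Rightarrow> ('e \<Rightarrow> 'v set) \<Rightarrow> bool" where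
  "is_path_graph W X ends \<longleftrightarrow>
     (\<exists>ws. ws \<noteq> [] \<and> distinct ws \<and> set ws = W \<and>
           bij_betw ends X {{ws ! i, ws ! Suc i} | i. Suc i < length ws})"

definition weak_dual_is_path ::
    "'a set \<Rightarrow> 'a set set \<Rightarrow> ('a \<Rightarrow> complex) \<Rightarrow> ('a set \<Rightarrow> real \<Rightarrow> complex) \<Rightarrow> bool" where
  "weak_dual_is_path V E p \<gamma> \<longleftrightarrow>
     is_path_graph (weak_dual_vertices V E p \<gamma>) (weak_dual_edges V E p \<gamma>) (dual_ends V E p \<gamma>)"

end

theory Submission
  imports Defs
begin

text \<open>
  If three arcs with common ends form a theta curve, then by Janiszewski's theorem one of them runs
  inside the closed curve formed by the other two. Since no vertex of an outerplane graph lies inside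
  a closed curve of the graph, there is no theta subgraph with three inner vertices and the chords of a
  cycle do not cross. Splitting at cut vertices, and using a longest cycle when there is none, gives a
  linear order of the vertices in which no two edges cross. Conversely, such an order yields an
  outerplanar drawing with straight chords between points of a parabola, so a maximal outerplanar graph
  is maximal noncrossing for its order, that is, a triangulated polygon.

  The inside of a triangle is a face, and an edge in two triangles is not on the outer face. A triangle
  all of whose edges lie in two triangles would therefore be a vertex of degree three in the weak dual.
  Hence the triangulation is a strip: it grows from an edge by gluing triangles, each time to one of the
  two edges at the vertex added last. A finite-state argument along the strip even gives a
  proper 5-orientation.
\<close>

subsection \<open>Theta curves\<close>

text \<open>The two configurations excluded by topology are the forbidden subdivisions for
  outerplanar graphs: a theta with three inner vertices is a subdivided \<open>K_{2,3}\<close>, and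
  a cycle with two crossing chords is a subdivided \<open>K_4\<close>. Edges are arbitrary Jordan
  arcs, so neither a boundary cycle nor the faces can be read off the drawing. The topology is
  therefore reduced to two facts about a subgraph: no vertex lies inside it, and an edge that enters
  its inside has both ends on it. These yield the vertex order, after which the argument is about a
  list; faces come back only for triangles, where the weak dual is consulted. The drawing on the
  parabola need not extend the given one, since maximality speaks of the graph and not of an
  embedding.\<close>

lemma connected_meets_inside_subset:
  assumes "connected C" "C \<inter> Z = {}" "C \<inter> inside Z \<noteq> {}"
  shows "C \<subseteq> inside Z"
proof
  fix y assume y: "y \<in> C"
  obtain x where x: "x \<in> C" "x \<in> inside Z" using assms by blast
  have "connected_component (- Z) x y"
    unfolding connected_component_def using assms x y by blast
  then show "y \<in> inside Z" using x inside_same_component by blast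
qed

lemma arc_closed_curve:
  fixes g h :: "real \<Rightarrow> complex"
  assumes "arc g" "arc h" "pathstart g = a" "pathfinish g = b" "pathstart h = a" "pathfinish h = b"
    and "path_image g \<inter> path_image h = {a, b}"
  defines "Z \<equiv> path_image g \<union> path_image h"
  shows "inside Z \<noteq> {}" "connected (inside Z)" "frontier (inside Z) = Z" "connected (outside Z)" "compact Z"
proof -
  let ?c = "g +++ reversepath h"
  have sp: "simple_path ?c"
    using assms by (intro simple_path_join_loop) (auto simp: arc_reversepath)
  have im: "path_image ?c = Z" using assms by (simp add: path_image_join)
  have "pathfinish ?c = pathstart ?c" using assms by simp
  from Jordan_inside_outside[OF sp this] im
  show "inside Z \<noteq> {}" "connected (inside Z)" "frontier (inside Z) = Z" "connected (outside Z)" by auto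
  show "compact Z" unfolding Z_def using assms by (simp add: compact_Un compact_arc_image)
qed

locale theta =
  fixes f g h :: "real \<Rightarrow> complex" and a b :: complex
  assumes arcs: "arc f" "arc g" "arc h"
    and ends: "pathstart f = a" "pathfinish f = b" "pathstart g = a" "pathfinish g = b"
      "pathstart h = a" "pathfinish h = b"
    and meets: "path_image f \<inter> path_image g = {a, b}" "path_image f \<inter> path_image h = {a, b}"
      "path_image g \<inter> path_image h = {a, b}"
begin

text \<open>A point inside the curve of \<open>f\<close> and \<open>g\<close> that lies off
  \<open>h\<close> and inside neither of the other two curves would be joined to a far point
  \<open>y\<close> in the complement of each of them. Those two curves share exactly the connected
  set \<open>path_image h\<close>, so Janiszewski's theorem joins the point to \<open>y\<close> off
  their union, which puts it outside the curve of \<open>f\<close> and \<open>g\<close>.\<close>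

lemma inside_cover:
  "inside (path_image f \<union> path_image g) \<subseteq>
     inside (path_image f \<union> path_image h) \<union> inside (path_image g \<union> path_image h) \<union> path_image h"
proof
  let ?F = "path_image f" and ?G = "path_image g" and ?H = "path_image h"
  have ab: "a \<in> ?F" "b \<in> ?F" "a \<in> ?G" "b \<in> ?G" "a \<in> ?H" "b \<in> ?H"
    using meets by auto
  note fh = arc_closed_curve[OF arcs(1,3) ends(1,2,5,6) meets(2)]
    and gh = arc_closed_curve[OF arcs(2,3) ends(3-6) meets(3)]
  fix x assume x: "x \<in> inside (?F \<union> ?G)"
  show "x \<in> inside (?F \<union> ?H) \<union> inside (?G \<union> ?H) \<union> ?H"
  proof (rule ccontr)
    assume n: "x \<notin> inside (?F \<union> ?H) \<union> inside (?G \<union> ?H) \<union> ?H"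
    have "x \<notin> ?F" "x \<notin> ?G" using x inside_no_overlap by blast+
    then have xo: "x \<in> outside (?F \<union> ?H)" "x \<in> outside (?G \<union> ?H)"
      using n outside_inside by blast+
    have "bounded ((?F \<union> ?H) \<union> (?G \<union> ?H))" using fh(5) gh(5) compact_imp_bounded by blast
    then obtain y where y: "y \<in> outside ((?F \<union> ?H) \<union> (?G \<union> ?H))"
      using outside_bounded_nonempty by blast
    then have yo: "y \<in> outside (?F \<union> ?H)" "y \<in> outside (?G \<union> ?H)"
      by (rule subsetD[OF outside_mono, rotated], blast)+
    have "connected_component (- (?F \<union> ?H)) x y"
      unfolding connected_component_def using fh(4) xo yo outside_no_overlap by blast
    moreover have "connected_component (- (?G \<union> ?H)) x y"
      unfolding connected_component_def using gh(4) xo yo outside_no_overlap by blast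
    moreover have "(?F \<union> ?H) \<inter> (?G \<union> ?H) = ?H" using meets(1) ab by auto
    moreover have "connected ?H" using arcs(3) by (simp add: arc_imp_path connected_path_image)
    ultimately have "connected_component (- ((?F \<union> ?H) \<union> (?G \<union> ?H))) x y"
      using Janiszewski fh(5) gh(5) compact_imp_closed by metis
    then have "x \<in> outside ((?F \<union> ?H) \<union> (?G \<union> ?H))"
      by (rule outside_same_component[OF connected_component_sym y])
    then have "x \<in> outside (?F \<union> ?G)" by (rule subsetD[OF outside_mono, rotated]) blast
    then show False using x by (meson disjoint_iff inside_Int_outside)
  qed
qed

end

text \<open>If \<open>f\<close> stays out of the region inside \<open>g\<close> and
  \<open>h\<close>, that region misses \<open>f\<close> altogether. By \<open>inside_cover\<close>
  one of its points, and by connectedness all of it, lies inside the curve formed by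
  \<open>f\<close> with \<open>g\<close> or with \<open>h\<close>. The remaining arc is part of the
  frontier of the region and is carried along.\<close>

lemma theta_inside:
  assumes "theta f g h a b"
  shows "path_image f - {a, b} \<subseteq> inside (path_image g \<union> path_image h) \<or>
         path_image g - {a, b} \<subseteq> inside (path_image f \<union> path_image h) \<or>
         path_image h - {a, b} \<subseteq> inside (path_image f \<union> path_image g)"
proof (cases "(path_image f - {a, b}) \<inter> inside (path_image g \<union> path_image h) = {}")
  case False
  interpret theta f g h a b by fact
  have "connected (path_image f - {a, b})"
    using connected_simple_path_endless[OF arc_imp_simple_path[OF arcs(1)]] ends by simp
  moreover have "(path_image f - {a, b}) \<inter> (path_image g \<union> path_image h) = {}" using meets by blast
  ultimately show ?thesis using connected_meets_inside_subset False by blast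
next
  case True
  interpret theta f g h a b by fact
  interpret r: theta g h f a b by unfold_locales (use arcs ends meets in blast)+
  let ?F = "path_image f" and ?G = "path_image g" and ?H = "path_image h"
  have ab: "a \<in> ?G" "b \<in> ?G" using meets by auto
  note fg = arc_closed_curve[OF arcs(1,2) ends(1-4) meets(1)]
    and fh = arc_closed_curve[OF arcs(1,3) ends(1,2,5,6) meets(2)]
    and gh = arc_closed_curve[OF arcs(2,3) ends(3-6) meets(3)]
  have disj: "?F \<inter> inside (?G \<union> ?H) = {}"
    using True ab inside_no_overlap[of "?G \<union> ?H"] by blast
  \<comment> \<open>\<open>Z\<close> is the curve formed by \<open>f\<close> with one of
    \<open>g\<close> and \<open>h\<close>; \<open>K\<close> is the other one.\<close>
  have key: "K - {a, b} \<subseteq> inside Z"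
    if "inside (?G \<union> ?H) \<inter> inside Z \<noteq> {}" "inside (?G \<union> ?H) \<inter> Z = {}" "K \<subseteq> ?G \<union> ?H"
       "(K - {a, b}) \<inter> Z = {}" "closed Z" for K Z
  proof -
    have "inside (?G \<union> ?H) \<subseteq> inside Z"
      using connected_meets_inside_subset gh(2) that(1,2) by blast
    then have "closure (inside (?G \<union> ?H)) \<subseteq> Z \<union> inside Z"
      using closure_inside_subset[OF that(5)] closure_mono by blast
    moreover have "?G \<union> ?H \<subseteq> closure (inside (?G \<union> ?H))"
      using gh(3) frontier_def by (metis Diff_subset)
    ultimately show ?thesis using that(3,4) by blast
  qed
  obtain x where x: "x \<in> inside (?G \<union> ?H)" using gh(1) by blast
  then have "x \<in> inside (?G \<union> ?F) \<or> x \<in> inside (?H \<union> ?F)" using r.inside_cover disj by blast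
  then show ?thesis
  proof
    assume "x \<in> inside (?G \<union> ?F)"
    then have "?H - {a, b} \<subseteq> inside (?F \<union> ?G)"
    proof (intro key)
      show "inside (?G \<union> ?H) \<inter> inside (?F \<union> ?G) \<noteq> {}"
        using x \<open>x \<in> inside (?G \<union> ?F)\<close> by (auto simp: Un_commute)
      show "inside (?G \<union> ?H) \<inter> (?F \<union> ?G) = {}" "(?H - {a, b}) \<inter> (?F \<union> ?G) = {}"
        using disj inside_no_overlap[of "?G \<union> ?H"] meets by blast+
    qed (use fg(5) compact_imp_closed in auto)
    then show ?thesis by blast
  next
    assume "x \<in> inside (?H \<union> ?F)"
    then have "?G - {a, b} \<subseteq> inside (?F \<union> ?H)"
    proof (intro key)
      show "inside (?G \<union> ?H) \<inter> inside (?F \<union> ?H) \<noteq> {}"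
        using x \<open>x \<in> inside (?H \<union> ?F)\<close> by (auto simp: Un_commute)
      show "inside (?G \<union> ?H) \<inter> (?F \<union> ?H) = {}" "(?G - {a, b}) \<inter> (?F \<union> ?H) = {}"
        using disj inside_no_overlap[of "?G \<union> ?H"] meets by blast+
    qed (use fh(5) compact_imp_closed in auto)
    then show ?thesis by blast
  qed
qed

subsection \<open>Walks and cycles in an outerplane graph\<close>

fun walk_edges :: "'a list \<Rightarrow> 'a set set" where
  "walk_edges (x # y # zs) = insert {x, y} (walk_edges (y # zs))"
| "walk_edges _ = {}"

lemma walk_edges_subset: "e \<in> walk_edges xs \<Longrightarrow> e \<subseteq> set xs"
  by (induction xs rule: walk_edges.induct) auto

lemma Union_walk_edges: "length xs \<ge> 2 \<Longrightarrow> \<Union>(walk_edges xs) = set xs"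
proof (induction xs rule: walk_edges.induct)
  case (1 x y zs)
  then show ?case by (cases zs) auto
qed auto

lemma walk_edges_append: "walk_edges (xs @ y # zs) = walk_edges (xs @ [y]) \<union> walk_edges (y # zs)"
proof (induction xs)
  case (Cons x xs)
  then show ?case by (cases xs) auto
qed simp

lemma walk_edges_rev: "walk_edges (rev xs) = walk_edges xs"
proof (induction xs rule: walk_edges.induct)
  case (1 x y zs)
  have "walk_edges (rev (x # y # zs)) = walk_edges (rev (y # zs)) \<union> walk_edges [y, x]"
    using walk_edges_append[of "rev zs" y "[x]"] by simp
  then show ?case using 1 by (auto simp: insert_commute)
qed simp_all

text \<open>Makes walks with disjoint inner vertices edge-disjoint, as \<open>edge_image_Int\<close>
  requires. A one-edge walk has no inner vertex, hence \<open>A \<noteq> []\<close>.\<close>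

lemma walk_edges_meets_inner:
  assumes "A \<noteq> []" "e \<in> walk_edges (a # A @ [b])"
  shows "e \<inter> set A \<noteq> {}"
  using assms
proof (induction A arbitrary: a)
  case (Cons x A)
  then show ?case by (cases "A = []") auto
qed simp

definition theta_free :: "'a set set \<Rightarrow> bool" where
  "theta_free E \<longleftrightarrow> (\<forall>a b A B C. A \<noteq> [] \<and> B \<noteq> [] \<and> C \<noteq> [] \<and> distinct (a # b # A @ B @ C) \<longrightarrow>
     \<not> walk_edges (a # A @ [b]) \<union> walk_edges (a # B @ [b]) \<union> walk_edges (a # C @ [b]) \<subseteq> E)"

text \<open>Two vertices joined by an edge count as a cycle, so that the search for a longest cycle
  can start from any edge.\<close>

definition cycle_edges :: "'a list \<Rightarrow> 'a set set" where
  "cycle_edges xs = walk_edges (xs @ [hd xs])"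

text \<open>The connectedness arguments control only the interior of an arc; taking closures passes
  their conclusions on to its ends.\<close>

lemma closure_arc_endless:
  assumes "arc g"
  shows "path_image g \<subseteq> closure (path_image g - {pathstart g, pathfinish g})"
proof -
  have "continuous_on (closure {0<..<1}) g"
    using assms by (simp add: arc_def path_def closure_greaterThanLessThan)
  then have "g ` closure {0<..<1} \<subseteq> closure (g ` {0<..<1})"
    by (intro image_closure_subset) (auto simp: closure_subset)
  then show ?thesis
    using simple_path_endless[OF arc_imp_simple_path[OF assms]]
    by (simp add: path_image_def closure_greaterThanLessThan)
qed

locale outerplane =
  fixes V :: "'a set" and E :: "'a set set" and p :: "'a \<Rightarrow> complex" and \<gamma> :: "'a set \<Rightarrow> real \<Rightarrow> complex"
  assumes outerplane: "outerplane_embedding V E p \<gamma>"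
begin

lemma graph: "simple_graph V E" "finite V" "e \<in> E \<Longrightarrow> e \<subseteq> V" "e \<in> E \<Longrightarrow> card e = 2"
  using outerplane unfolding outerplane_embedding_def plane_embedding_def simple_graph_def by blast+

lemma finite_edges: "finite E"
proof (rule finite_subset)
  show "E \<subseteq> Pow V" using graph by blast
qed (simp add: graph)

lemma inj_p: "inj_on p V"
  and arc_edge: "e \<in> E \<Longrightarrow> arc (\<gamma> e)"
  and edge_ends: "e \<in> E \<Longrightarrow> {pathstart (\<gamma> e), pathfinish (\<gamma> e)} = p ` e"
  and edge_vertices: "e \<in> E \<Longrightarrow> path_image (\<gamma> e) \<inter> p ` V = p ` e"
  and edges_meet: "e \<in> E \<Longrightarrow> f \<in> E \<Longrightarrow> e \<noteq> f \<Longrightarrow> path_image (\<gamma> e) \<inter> path_image (\<gamma> f) = p ` (e \<inter> f)"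
  using outerplane unfolding outerplane_embedding_def plane_embedding_def by blast+

definition edge_image :: "'a set set \<Rightarrow> complex set" where
  "edge_image F = (\<Union>e\<in>F. path_image (\<gamma> e))"

lemma edge_image_Un: "edge_image (F \<union> G) = edge_image F \<union> edge_image G"
  unfolding edge_image_def by blast

lemma edge_image_subset: "F \<subseteq> E \<Longrightarrow> edge_image F \<subseteq> point_set V E p \<gamma>"
  unfolding edge_image_def point_set_def by blast

lemma compact_edge_image: "F \<subseteq> E \<Longrightarrow> compact (edge_image F)"
  unfolding edge_image_def
  by (intro compact_UN) (use finite_edges finite_subset arc_edge compact_arc_image in blast)+

lemma edge_image_Int:
  assumes "F \<subseteq> E" "G \<subseteq> E" "F \<inter> G = {}"
  shows "edge_image F \<inter> edge_image G = p ` (\<Union>F \<inter> \<Union>G)"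
proof -
  have "edge_image F \<inter> edge_image G = (\<Union>e\<in>F. \<Union>f\<in>G. path_image (\<gamma> e) \<inter> path_image (\<gamma> f))"
    unfolding edge_image_def by blast
  also have "\<dots> = (\<Union>e\<in>F. \<Union>f\<in>G. p ` (e \<inter> f))"
    using assms edges_meet by (intro SUP_cong refl) blast
  also have "\<dots> = p ` (\<Union>F \<inter> \<Union>G)" by blast
  finally show ?thesis .
qed

lemma vertex_in_edge_image:
  assumes "F \<subseteq> E" "v \<in> V"
  shows "p v \<in> edge_image F \<longleftrightarrow> v \<in> \<Union>F"
proof
  assume "p v \<in> edge_image F"
  then obtain e where e: "e \<in> F" "p v \<in> path_image (\<gamma> e)" unfolding edge_image_def by blast
  then have "p v \<in> p ` e" using edge_vertices[of e] assms by blast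
  moreover have "e \<subseteq> V" using e graph(3) assms by blast
  ultimately have "v \<in> e" using inj_p assms(2) by (auto simp: inj_on_def)
  then show "v \<in> \<Union>F" using e by blast
next
  assume "v \<in> \<Union>F"
  then obtain e where "e \<in> F" "v \<in> e" by blast
  then show "p v \<in> edge_image F" using edge_vertices[of e] assms unfolding edge_image_def by blast
qed

lemma closed_edge_image: "F \<subseteq> E \<Longrightarrow> closed (edge_image F)"
  by (simp add: compact_edge_image compact_imp_closed)

text \<open>The outer face of the graph lies in the outside of every subgraph, and
  \<open>inside\<close> is open, so it misses the closure of the outer face as well. This is applied
  to vertices in \<open>vertex_not_inside\<close> and to edges in
  \<open>two_triangles_weak_dual_edge\<close>.\<close>

lemma inside_misses_outer_frontier:
  assumes "F \<subseteq> E"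
  shows "inside (edge_image F) \<inter> frontier (outer_face V E p \<gamma>) = {}"
proof -
  have "outside (point_set V E p \<gamma>) \<subseteq> outside (edge_image F)"
    using edge_image_subset[OF assms] by (rule outside_mono)
  then have "inside (edge_image F) \<inter> outside (point_set V E p \<gamma>) = {}"
    by (meson disjoint_iff inside_Int_outside subsetD)
  then have "inside (edge_image F) \<inter> closure (outside (point_set V E p \<gamma>)) = {}"
    using open_inside[OF closed_edge_image[OF assms]] open_Int_closure_eq_empty by blast
  then show ?thesis unfolding outer_face_def frontier_def by blast
qed

lemma vertex_not_inside:
  assumes "F \<subseteq> E" "v \<in> V"
  shows "p v \<notin> inside (edge_image F)"
proof -
  have "p v \<in> frontier (outer_face V E p \<gamma>)"
    using outerplane assms(2) unfolding outerplane_embedding_def by blast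
  then show ?thesis using inside_misses_outer_frontier[OF assms(1)] by blast
qed

text \<open>The interior of the arc is connected and misses \<open>edge_image F\<close>, because
  arcs meet only in common vertices; so it lies inside as a whole. The ends then lie in the closure
  of the inside, and since no vertex lies inside, they are on \<open>edge_image F\<close>.\<close>

lemma edge_meets_inside:
  assumes F: "F \<subseteq> E" and e: "e \<in> E" "e \<notin> F"
    and meets: "path_image (\<gamma> e) \<inter> inside (edge_image F) \<noteq> {}"
  shows "e \<subseteq> \<Union>F"
proof
  let ?Z = "edge_image F" and ?I = "path_image (\<gamma> e) - {pathstart (\<gamma> e), pathfinish (\<gamma> e)}"
  have ends: "{pathstart (\<gamma> e), pathfinish (\<gamma> e)} = p ` e" using edge_ends e by blast
  have eV: "e \<subseteq> V" using e graph by blast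
  have "path_image (\<gamma> e) \<inter> ?Z = p ` (e \<inter> \<Union>F)"
    using edge_image_Int[of "{e}" F] F e by (simp add: edge_image_def)
  then have disj: "?I \<inter> ?Z = {}" using ends by blast
  have "connected ?I"
    using arc_edge[OF e(1)] connected_simple_path_endless arc_imp_simple_path by blast
  moreover have "?I \<inter> inside ?Z \<noteq> {}"
  proof -
    have "p ` e \<inter> inside ?Z = {}" using vertex_not_inside[OF F] eV by blast
    then show ?thesis unfolding ends using meets by blast
  qed
  ultimately have "?I \<subseteq> inside ?Z" using connected_meets_inside_subset disj by blast
  then have "closure ?I \<subseteq> ?Z \<union> inside ?Z"
    using closure_inside_subset[OF closed_edge_image[OF F]] closure_mono by blast
  then have "path_image (\<gamma> e) \<subseteq> ?Z \<union> inside ?Z"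
    using closure_arc_endless[OF arc_edge[OF e(1)]] by blast
  moreover fix v assume v: "v \<in> e"
  moreover have "p v \<in> path_image (\<gamma> e)" using v edge_vertices[OF e(1)] by blast
  ultimately have "p v \<in> ?Z" using vertex_not_inside[OF F] eV by blast
  then show "v \<in> \<Union>F" using vertex_in_edge_image[OF F] v eV by blast
qed

lemma walk_arc:
  assumes "distinct xs" "walk_edges xs \<subseteq> E" "length xs \<ge> 2"
  shows "\<exists>g. arc g \<and> pathstart g = p (hd xs) \<and> pathfinish g = p (last xs) \<and> path_image g = edge_image (walk_edges xs)"
  using assms
proof (induction xs rule: walk_edges.induct)
  case (1 x y zs)
  have e: "{x, y} \<in> E" using 1 by simp
  have "{pathstart (\<gamma> {x, y}), pathfinish (\<gamma> {x, y})} = {p x, p y}" using edge_ends[OF e] by simp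
  \<comment> \<open>The drawing does not prescribe at which end of an edge its arc starts.\<close>
  then consider "pathstart (\<gamma> {x, y}) = p x" "pathfinish (\<gamma> {x, y}) = p y"
    | "pathstart (\<gamma> {x, y}) = p y" "pathfinish (\<gamma> {x, y}) = p x"
    by (auto simp: doubleton_eq_iff)
  then obtain h where h: "arc h" "pathstart h = p x" "pathfinish h = p y" "path_image h = path_image (\<gamma> {x, y})"
  proof cases
    case 1
    then show ?thesis using that arc_edge[OF e] by blast
  next
    case 2
    then show ?thesis using that[of "reversepath (\<gamma> {x, y})"] arc_edge[OF e] by (simp add: arc_reversepath)
  qed
  show ?case
  proof (cases zs)
    case Nil
    then show ?thesis using h by (intro exI[of _ h]) (simp add: edge_image_def)
  next
    case (Cons z zs')
    let ?F = "walk_edges (y # zs)"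
    obtain g where g: "arc g" "pathstart g = p y" "pathfinish g = p (last (y # zs))" "path_image g = edge_image ?F"
      using 1 Cons by auto
    have "{x, y} \<notin> ?F" using walk_edges_subset[of "{x, y}" "y # zs"] 1 by auto
    then have "edge_image {{x, y}} \<inter> edge_image ?F = p ` (\<Union>{{x, y}} \<inter> \<Union>?F)"
      using 1 by (intro edge_image_Int) auto
    also have "\<Union>{{x, y}} \<inter> \<Union>?F = {y}"
      using Union_walk_edges[of "y # zs"] Cons 1 by auto
    finally have "path_image h \<inter> path_image g \<subseteq> {pathstart g}"
      using h g by (simp add: edge_image_def)
    then have "arc (h +++ g)" using h g by (intro arc_join) auto
    moreover have "path_image (h +++ g) = edge_image (walk_edges (x # y # zs))"
      using h g by (simp add: path_image_join edge_image_def)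
    ultimately show ?thesis using h g by (intro exI[of _ "h +++ g"]) simp
  qed
qed auto

text \<open>\<open>C\<close> may be empty, and the third arc is then the edge \<open>{a, b}\<close>
  itself; this serves chords as well as thetas with three inner vertices.\<close>

lemma walks_theta:
  assumes ab: "a \<noteq> b" and dist: "distinct (a # A @ [b])" "distinct (a # B @ [b])" "distinct (a # C @ [b])"
    and disj: "set A \<inter> set B = {}" "set A \<inter> set C = {}" "set B \<inter> set C = {}"
    and ne: "A \<noteq> []" "B \<noteq> []"
    and sub: "walk_edges (a # A @ [b]) \<subseteq> E" "walk_edges (a # B @ [b]) \<subseteq> E" "walk_edges (a # C @ [b]) \<subseteq> E"
  obtains f g h where "theta f g h (p a) (p b)" "path_image f = edge_image (walk_edges (a # A @ [b]))"
    "path_image g = edge_image (walk_edges (a # B @ [b]))" "path_image h = edge_image (walk_edges (a # C @ [b]))"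
proof -
  have walk: "\<exists>g. arc g \<and> pathstart g = p a \<and> pathfinish g = p b \<and> path_image g = edge_image (walk_edges (a # X @ [b]))"
    if "distinct (a # X @ [b])" "walk_edges (a # X @ [b]) \<subseteq> E" for X
    using walk_arc[OF that] by simp
  have meet: "edge_image (walk_edges (a # X @ [b])) \<inter> edge_image (walk_edges (a # Y @ [b])) = {p a, p b}"
    if "X \<noteq> []" "set X \<inter> set Y = {}" "distinct (a # X @ [b])" "distinct (a # Y @ [b])"
      "walk_edges (a # X @ [b]) \<subseteq> E" "walk_edges (a # Y @ [b]) \<subseteq> E" for X Y
  proof -
    have "walk_edges (a # X @ [b]) \<inter> walk_edges (a # Y @ [b]) = {}"
    proof (rule ccontr)
      assume "walk_edges (a # X @ [b]) \<inter> walk_edges (a # Y @ [b]) \<noteq> {}"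
      then obtain e where e: "e \<in> walk_edges (a # X @ [b])" "e \<in> walk_edges (a # Y @ [b])" by blast
      have "e \<inter> set X \<noteq> {}" using walk_edges_meets_inner[OF that(1) e(1)] .
      moreover have "e \<subseteq> {a, b} \<union> set Y" using walk_edges_subset[OF e(2)] by auto
      ultimately show False using that(2,3) by auto
    qed
    then have "edge_image (walk_edges (a # X @ [b])) \<inter> edge_image (walk_edges (a # Y @ [b])) =
        p ` (\<Union>(walk_edges (a # X @ [b])) \<inter> \<Union>(walk_edges (a # Y @ [b])))"
      using that by (intro edge_image_Int)
    also have "\<Union>(walk_edges (a # X @ [b])) \<inter> \<Union>(walk_edges (a # Y @ [b])) = {a, b}"
      using Union_walk_edges[of "a # X @ [b]"] Union_walk_edges[of "a # Y @ [b]"] that by auto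
    finally show ?thesis by simp
  qed
  obtain f where f: "arc f" "pathstart f = p a" "pathfinish f = p b" "path_image f = edge_image (walk_edges (a # A @ [b]))"
    using walk[OF dist(1) sub(1)] by blast
  obtain g where g: "arc g" "pathstart g = p a" "pathfinish g = p b" "path_image g = edge_image (walk_edges (a # B @ [b]))"
    using walk[OF dist(2) sub(2)] by blast
  obtain h where h: "arc h" "pathstart h = p a" "pathfinish h = p b" "path_image h = edge_image (walk_edges (a # C @ [b]))"
    using walk[OF dist(3) sub(3)] by blast
  have "theta f g h (p a) (p b)"
  proof
    show "path_image f \<inter> path_image g = {p a, p b}" unfolding f g
      using meet[OF ne(1) disj(1) dist(1,2) sub(1,2)] .
    show "path_image f \<inter> path_image h = {p a, p b}" unfolding f h
      using meet[OF ne(1) disj(2) dist(1,3) sub(1,3)] .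
    show "path_image g \<inter> path_image h = {p a, p b}" unfolding g h
      using meet[OF ne(2) disj(3) dist(2,3) sub(2,3)] .
  qed (use f g h in auto)
  then show thesis using that f g h by blast
qed

lemma walk_not_inside:
  assumes "X \<noteq> []" "distinct (a # X @ [b])" "walk_edges (a # X @ [b]) \<subseteq> E" "F \<subseteq> E"
  shows "\<not> edge_image (walk_edges (a # X @ [b])) - {p a, p b} \<subseteq> inside (edge_image F)"
proof -
  obtain x where x: "x \<in> set X" using assms(1) by (cases X) auto
  have un: "\<Union>(walk_edges (a # X @ [b])) = set (a # X @ [b])" by (rule Union_walk_edges) simp
  then have "set (a # X @ [b]) \<subseteq> V" using assms(3) graph(3) by blast
  then have V: "x \<in> V" "a \<in> V" "b \<in> V" using x by auto
  have "p x \<in> edge_image (walk_edges (a # X @ [b]))"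
    using vertex_in_edge_image[OF assms(3) V(1)] un x by auto
  moreover have "p x \<noteq> p a" "p x \<noteq> p b" using inj_p V x assms(2) by (auto simp: inj_on_def)
  ultimately show ?thesis using vertex_not_inside[OF assms(4) V(1)] by blast
qed

lemma theta_free: "theta_free E"
  unfolding theta_free_def
proof (intro allI impI notI)
  fix a b :: 'a and A B C
  let ?W = "\<lambda>X. walk_edges (a # X @ [b])"
  assume as: "A \<noteq> [] \<and> B \<noteq> [] \<and> C \<noteq> [] \<and> distinct (a # b # A @ B @ C)" "?W A \<union> ?W B \<union> ?W C \<subseteq> E"
  obtain f g h where th: "theta f g h (p a) (p b)" "path_image f = edge_image (?W A)"
    "path_image g = edge_image (?W B)" "path_image h = edge_image (?W C)"
    by (rule walks_theta[of a b A B C]) (use as in auto)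
  have n: "\<not> edge_image (?W X) - {p a, p b} \<subseteq> inside (edge_image (?W Y) \<union> edge_image (?W Z))"
    if "X \<in> {A, B, C}" "Y \<in> {A, B, C}" "Z \<in> {A, B, C}" for X Y Z
    unfolding edge_image_Un[symmetric] by (rule walk_not_inside) (use as that in auto)
  then show False using theta_inside[OF th(1)] n[of A B C] n[of B A C] n[of C A B] unfolding th by simp
qed

end

section \<open>Chords of a cycle\<close>

text \<open>One side of the cycle is reversed so that both walks run from \<open>a\<close> to
  \<open>c\<close>, the form that \<open>walks_theta\<close> expects.\<close>

lemma cycle_edges_split:
  "cycle_edges (a # X @ c # Y) = walk_edges (a # X @ [c]) \<union> walk_edges (a # rev Y @ [c])"
proof -
  have "walk_edges (c # Y @ [a]) = walk_edges (a # rev Y @ [c])"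
    using walk_edges_rev[of "c # Y @ [a]"] by simp
  then show ?thesis
    using walk_edges_append[of "a # X" c "Y @ [a]"] by (simp add: cycle_edges_def)
qed

lemma cycle_edges_rotate: "cycle_edges (xs @ ys) = cycle_edges (ys @ xs)"
proof (cases "xs = [] \<or> ys = []")
  case False
  then obtain x xs' y ys' where "xs = x # xs'" "ys = y # ys'" by (meson neq_Nil_conv)
  moreover have "walk_edges (x # rev ys' @ [y]) = walk_edges (y # ys' @ [x])"
    "walk_edges (y # rev xs' @ [x]) = walk_edges (x # xs' @ [y])"
    using walk_edges_rev[of "y # ys' @ [x]"] walk_edges_rev[of "x # xs' @ [y]"] by simp_all
  ultimately show ?thesis
    using cycle_edges_split[of x xs' y ys'] cycle_edges_split[of y ys' x xs'] by auto
qed auto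

definition noncrossing :: "'a list \<Rightarrow> 'a set set \<Rightarrow> bool" where
  "noncrossing xs E \<longleftrightarrow> (\<forall>i j k l. i < j \<and> j < k \<and> k < l \<and> l < length xs \<longrightarrow>
     \<not> ({xs ! i, xs ! k} \<in> E \<and> {xs ! j, xs ! l} \<in> E))"

lemma list_split_four:
  assumes "i < j" "j < k" "k < l" "l < length xs"
  obtains X A B C D where "xs = X @ xs ! i # A @ xs ! j # B @ xs ! k # C @ xs ! l # D"
proof -
  have split: "\<exists>Y. drop m xs = Y @ drop n xs" if "m \<le> n" for m n
    using that by (metis append_take_drop_id drop_drop le_add_diff_inverse2)
  have cons: "drop m xs = xs ! m # drop (Suc m) xs" if "m < length xs" for m
    using that by (simp add: Cons_nth_drop_Suc)
  obtain X A B C where "drop 0 xs = X @ drop i xs" "drop (Suc i) xs = A @ drop j xs"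
    "drop (Suc j) xs = B @ drop k xs" "drop (Suc k) xs = C @ drop l xs"
    using split[of 0 i] split[of "Suc i" j] split[of "Suc j" k] split[of "Suc k" l] assms by auto
  then show thesis using that[of X A B C "drop (Suc l) xs"] cons[of i] cons[of j] cons[of k] cons[of l] assms
    by simp
qed

text \<open>The combinatorial stand-in for an inner edge: the later argument about triangulated
  polygons sees the weak dual only through this predicate.\<close>

definition two_triangles :: "'a set set \<Rightarrow> 'a \<Rightarrow> 'a \<Rightarrow> bool" where
  "two_triangles E a b \<longleftrightarrow> (\<exists>c d. c \<noteq> d \<and> {a, c} \<in> E \<and> {b, c} \<in> E \<and> {a, d} \<in> E \<and> {b, d} \<in> E)"

context outerplane
begin

lemma edge_neq: "{u, v} \<in> E \<Longrightarrow> u \<noteq> v"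
  using graph(4)[of "{u, v}"] by auto

text \<open>One of the three arcs lies inside the curve of the other two. It cannot be a walk with
  an inner vertex, since vertices are never inside; only the chord is left.\<close>

lemma chord_theta:
  assumes dist: "distinct (a # b # A @ B)" and ne: "A \<noteq> []" "B \<noteq> []"
    and sub: "walk_edges (a # A @ [b]) \<subseteq> E" "walk_edges (a # B @ [b]) \<subseteq> E" "{a, b} \<in> E"
  obtains f g h where "theta f g h (p a) (p b)" "path_image f = edge_image (walk_edges (a # A @ [b]))"
    "path_image g = edge_image (walk_edges (a # B @ [b]))" "path_image h = path_image (\<gamma> {a, b})"
    "path_image (\<gamma> {a, b}) - {p a, p b} \<subseteq> inside (edge_image (walk_edges (a # A @ [b]) \<union> walk_edges (a # B @ [b])))"
proof -
  let ?W = "\<lambda>X. walk_edges (a # X @ [b])"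
  obtain f g h where th: "theta f g h (p a) (p b)" "path_image f = edge_image (?W A)"
    "path_image g = edge_image (?W B)" "path_image h = edge_image (?W [])"
    by (rule walks_theta[of a b A B "[]"]) (use assms in auto)
  have h: "path_image h = path_image (\<gamma> {a, b})" using th by (simp add: edge_image_def)
  have n: "\<not> edge_image (?W X) - {p a, p b} \<subseteq> inside (edge_image (?W Y) \<union> edge_image (?W Z))"
    if "X \<in> {A, B}" "Y \<in> {A, B, []}" "Z \<in> {A, B, []}" for X Y Z
    unfolding edge_image_Un[symmetric] by (rule walk_not_inside) (use assms that in auto)
  have "path_image h - {p a, p b} \<subseteq> inside (path_image f \<union> path_image g)"
    using theta_inside[OF th(1)] n[of A B "[]"] n[of B A "[]"] unfolding th by simp
  then show thesis using that[OF th(1-3) h] th h by (simp add: edge_image_Un)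
qed

lemma edge_interior_point:
  assumes "e \<in> E"
  obtains z where "z \<in> path_image (\<gamma> e)" "z \<notin> p ` e"
proof -
  have "path_image (\<gamma> e) \<subseteq> closure (path_image (\<gamma> e) - p ` e)"
    using closure_arc_endless[OF arc_edge[OF assms]] edge_ends[OF assms] by simp
  then have "path_image (\<gamma> e) - p ` e \<noteq> {}"
    using path_image_nonempty[of "\<gamma> e"] closure_empty by (metis subset_empty)
  then show thesis using that by blast
qed

text \<open>The chord \<open>{b, d}\<close> runs inside the cycle. By \<open>inside_cover\<close> a
  point \<open>z\<close> of it, being off the chord \<open>{a, c}\<close>, lies inside one of the
  two cycles into which \<open>{a, c}\<close> splits the cycle. An edge entering such a cycle has
  both ends on it, but each of the two contains only one of \<open>b\<close> and
  \<open>d\<close>.\<close>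

lemma cycle_chords_do_not_cross:
  assumes dist: "distinct (a # A @ b # B @ c # C @ d # D)"
    and cyc: "cycle_edges (a # A @ b # B @ c # C @ d # D) \<subseteq> E"
    and ac: "{a, c} \<in> E" and bd: "{b, d} \<in> E"
  shows False
proof -
  let ?Y = "cycle_edges (a # A @ b # B @ c # C @ d # D)"
  let ?W1 = "walk_edges (a # (A @ b # B) @ [c])" and ?W2 = "walk_edges (a # rev (C @ d # D) @ [c])"
  let ?U1 = "walk_edges (b # (B @ c # C) @ [d])" and ?U2 = "walk_edges (b # rev (D @ a # A) @ [d])"
  have W: "?Y = ?W1 \<union> ?W2" using cycle_edges_split[of a "A @ b # B" c "C @ d # D"] by simp
  have "?Y = cycle_edges ((b # B @ c # C @ d # D) @ (a # A))"
    using cycle_edges_rotate[of "a # A" "b # B @ c # C @ d # D"] by simp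
  then have U: "?Y = ?U1 \<union> ?U2" using cycle_edges_split[of b "B @ c # C" d "D @ a # A"] by simp
  obtain f g h where th: "theta f g h (p a) (p c)" "path_image f = edge_image ?W1"
    "path_image g = edge_image ?W2" "path_image h = path_image (\<gamma> {a, c})"
    by (rule chord_theta[of a c "A @ b # B" "rev (C @ d # D)"]) (use dist cyc W ac in auto)
  have bdY: "path_image (\<gamma> {b, d}) - {p b, p d} \<subseteq> inside (edge_image ?Y)"
    unfolding U by (rule chord_theta[of b d "B @ c # C" "rev (D @ a # A)"]) (use dist cyc U bd in auto)
  obtain z where z: "z \<in> path_image (\<gamma> {b, d})" "z \<notin> {p b, p d}"
    using edge_interior_point[OF bd] by auto
  interpret theta f g h "p a" "p c" by (rule th)
  have "z \<in> inside (path_image f \<union> path_image g)"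
    using bdY z unfolding W edge_image_Un th by blast
  moreover have "z \<notin> path_image h"
  proof -
    have "{a, c} \<inter> {b, d} = {}" using dist by auto
    then show ?thesis using edges_meet[OF ac bd] z th by auto
  qed
  ultimately have cover: "z \<in> inside (path_image f \<union> path_image h) \<or> z \<in> inside (path_image g \<union> path_image h)"
    using inside_cover by blast
  have outer: "z \<notin> inside (edge_image (insert {a, c} F))"
    if "F \<subseteq> E" "\<not> {b, d} \<subseteq> \<Union>(insert {a, c} F)" for F
    using edge_meets_inside[of "insert {a, c} F" "{b, d}"] that ac bd z by blast
  have "\<Union>?W1 = set (a # (A @ b # B) @ [c])" "\<Union>?W2 = set (a # rev (C @ d # D) @ [c])"
    by (rule Union_walk_edges, simp)+
  then have "\<not> {b, d} \<subseteq> \<Union>(insert {a, c} ?W1)" "\<not> {b, d} \<subseteq> \<Union>(insert {a, c} ?W2)"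
    using dist by auto
  then have "z \<notin> inside (edge_image (insert {a, c} ?W1))" "z \<notin> inside (edge_image (insert {a, c} ?W2))"
    using outer cyc unfolding W by blast+
  moreover have "path_image f \<union> path_image h = edge_image (insert {a, c} ?W1)"
    "path_image g \<union> path_image h = edge_image (insert {a, c} ?W2)"
    unfolding th edge_image_def by auto
  ultimately show False using cover by simp
qed

lemma cycle_noncrossing:
  assumes "distinct xs" "cycle_edges xs \<subseteq> E"
  shows "noncrossing xs E"
  unfolding noncrossing_def
proof (intro allI impI notI, elim conjE)
  fix i j k l
  assume as: "i < j" "j < k" "k < l" "l < length xs" "{xs ! i, xs ! k} \<in> E" "{xs ! j, xs ! l} \<in> E"
  obtain X A B C D where xs: "xs = X @ xs ! i # A @ xs ! j # B @ xs ! k # C @ xs ! l # D"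
    using list_split_four[OF as(1-4)] by blast
  let ?ys = "xs ! i # A @ xs ! j # B @ xs ! k # C @ xs ! l # D"
  have "cycle_edges (?ys @ X) \<subseteq> E" using assms(2) cycle_edges_rotate[of ?ys X] xs by simp
  moreover have "distinct (?ys @ X)"
  proof -
    have "distinct (X @ ?ys)" using assms(1) xs by simp
    then show ?thesis by (simp only: distinct_append Int_commute conj_ac)
  qed
  ultimately show False
    using cycle_chords_do_not_cross[of "xs ! i" A "xs ! j" B "xs ! k" C "xs ! l" "D @ X"] as(5,6) by simp
qed

section \<open>Triangles and the weak dual\<close>

text \<open>No vertex is inside the triangle, and an edge entering it would have both ends among
  \<open>a\<close>, \<open>b\<close>, \<open>c\<close>, hence be a side, which lies on the curve. So
  the inside misses the whole drawing, and since its frontier belongs to the drawing, it is a full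
  component of the complement. The same \<open>F\<close> serves all three sides, which is what the
  count in the weak dual requires.\<close>

lemma triangle_face:
  assumes "{a, b} \<in> E" "{b, c} \<in> E" "{a, c} \<in> E"
  obtains F where "\<And>e. e \<in> {{a, b}, {b, c}, {a, c}} \<Longrightarrow> F \<in> dual_ends V E p \<gamma> e"
proof -
  let ?T = "{{a, b}, {b, c}, {a, c}}"
  let ?Z = "edge_image ?T" and ?S = "point_set V E p \<gamma>"
  have T: "?T \<subseteq> E" using assms by blast
  have ne: "a \<noteq> b" "b \<noteq> c" "a \<noteq> c" using assms edge_neq by blast+
  obtain f where f: "arc f" "pathstart f = p a" "pathfinish f = p c" "path_image f = edge_image {{a, b}, {b, c}}"
    using walk_arc[of "[a, b, c]"] assms ne by auto
  obtain g where g: "arc g" "pathstart g = p a" "pathfinish g = p c" "path_image g = edge_image {{a, c}}"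
    using walk_arc[of "[a, c]"] assms ne by auto
  have "edge_image {{a, b}, {b, c}} \<inter> edge_image {{a, c}} = p ` (\<Union>{{a, b}, {b, c}} \<inter> \<Union>{{a, c}})"
    using assms ne by (intro edge_image_Int) (auto simp: doubleton_eq_iff)
  also have "\<Union>{{a, b}, {b, c}} \<inter> \<Union>{{a, c}} = {a, c}" using ne by auto
  finally have "path_image f \<inter> path_image g = {p a, p c}" using f g by simp
  moreover have Z: "?Z = path_image f \<union> path_image g" unfolding f g edge_image_def by auto
  ultimately have I: "inside ?Z \<noteq> {}" "connected (inside ?Z)" "frontier (inside ?Z) = ?Z"
    using arc_closed_curve[OF f(1) g(1) f(2,3) g(2,3)] by simp_all
  have "inside ?Z \<inter> path_image (\<gamma> e) = {}" if e: "e \<in> E" for e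
  proof (rule ccontr)
    assume m: "inside ?Z \<inter> path_image (\<gamma> e) \<noteq> {}"
    have "e \<notin> ?T"
    proof
      assume "e \<in> ?T"
      then have "path_image (\<gamma> e) \<subseteq> ?Z" unfolding edge_image_def by blast
      then show False using m inside_no_overlap[of ?Z] by blast
    qed
    then have "e \<subseteq> {a, b, c}" using edge_meets_inside[OF T e] m by blast
    moreover have "card e = 2" using e graph by blast
    ultimately have "e \<in> ?T" by (auto simp: card_2_iff)
    then show False using \<open>e \<notin> ?T\<close> by blast
  qed
  moreover have "inside ?Z \<inter> p ` V = {}" using vertex_not_inside[OF T] by blast
  ultimately have "inside ?Z \<subseteq> - ?S" unfolding point_set_def by blast
  moreover have "D \<subseteq> inside ?Z" if "D \<subseteq> - ?S" "connected D" "inside ?Z \<inter> D \<noteq> {}" for D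
    using connected_meets_inside_subset[of D ?Z] that edge_image_subset[OF T] by blast
  ultimately have face: "inside ?Z \<in> faces V E p \<gamma>"
    unfolding faces_def in_components_maximal using I(1,2) by (simp add: subset_antisym Int_absorb2)
  have front: "path_image (\<gamma> e) \<subseteq> frontier (inside ?Z)" if "e \<in> ?T" for e
  proof -
    have "path_image (\<gamma> e) \<subseteq> ?Z" using that unfolding edge_image_def by blast
    then show ?thesis by (simp only: I(3))
  qed
  show thesis
  proof (rule that)
    show "inside ?Z \<in> dual_ends V E p \<gamma> e" if "e \<in> ?T" for e
      unfolding dual_ends_def using face front[OF that] by simp
  qed
qed

text \<open>The two triangles form a quadrilateral \<open>a, c, b, d\<close> with chord
  \<open>{a, b}\<close>. The chord runs inside it, away from the frontier of the outer face.\<close>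

lemma two_triangles_weak_dual_edge:
  assumes "{a, b} \<in> E" "two_triangles E a b"
  shows "{a, b} \<in> weak_dual_edges V E p \<gamma>"
proof -
  obtain c d where cd: "c \<noteq> d" "{a, c} \<in> E" "{b, c} \<in> E" "{a, d} \<in> E" "{b, d} \<in> E"
    using assms unfolding two_triangles_def by blast
  let ?F = "walk_edges (a # [c] @ [b]) \<union> walk_edges (a # [d] @ [b])"
  have ne: "a \<noteq> b" "a \<noteq> c" "b \<noteq> c" "a \<noteq> d" "b \<noteq> d" using assms cd edge_neq by blast+
  have F: "?F \<subseteq> E" using cd by (simp add: insert_commute)
  have "path_image (\<gamma> {a, b}) - {p a, p b} \<subseteq> inside (edge_image ?F)"
    by (rule chord_theta[of a b "[c]" "[d]"]) (use ne cd assms F in auto)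
  moreover obtain z where "z \<in> path_image (\<gamma> {a, b})" "z \<notin> {p a, p b}"
    using edge_interior_point[OF assms(1)] by auto
  ultimately have "\<not> path_image (\<gamma> {a, b}) \<subseteq> frontier (outer_face V E p \<gamma>)"
    using inside_misses_outer_frontier[OF F] by blast
  then show ?thesis using assms(1) unfolding weak_dual_edges_def dual_ends_def by blast
qed

lemma no_branching_triangle:
  assumes path: "weak_dual_is_path V E p \<gamma>"
    and tri: "{a, b} \<in> E" "{b, c} \<in> E" "{a, c} \<in> E"
    and two: "two_triangles E a b" "two_triangles E b c" "two_triangles E a c"
  shows False
proof -
  let ?X = "weak_dual_edges V E p \<gamma>" and ?ends = "dual_ends V E p \<gamma>"
  obtain ws where ws: "distinct ws" "bij_betw ?ends ?X {{ws ! i, ws ! Suc i} | i. Suc i < length ws}"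
    using path unfolding weak_dual_is_path_def is_path_graph_def by blast
  obtain F where F: "\<And>e. e \<in> {{a, b}, {b, c}, {a, c}} \<Longrightarrow> F \<in> ?ends e"
    using triangle_face[OF tri] by blast
  have X: "e \<in> ?X" if "e \<in> {{a, b}, {b, c}, {a, c}}" for e
    using that two_triangles_weak_dual_edge tri two by blast
  have "\<exists>i. Suc i < length ws \<and> ?ends e = {ws ! i, ws ! Suc i}" if "e \<in> {{a, b}, {b, c}, {a, c}}" for e
    using bij_betwE[OF ws(2)] X[OF that] by blast
  then obtain n where n: "\<And>e. e \<in> {{a, b}, {b, c}, {a, c}} \<Longrightarrow> Suc (n e) < length ws \<and> ?ends e = {ws ! n e, ws ! Suc (n e)}"
    by metis
  have "n {a, b} < length ws \<and> (F = ws ! n {a, b} \<or> F = ws ! Suc (n {a, b}))"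
    using n[of "{a, b}"] F[of "{a, b}"] by auto
  moreover have "Suc (n {a, b}) < length ws" using n by blast
  ultimately obtain m where m: "m < length ws" "F = ws ! m" by blast
  \<comment> \<open>\<open>F\<close> occurs in the pairs of the path only as right end of pair
    \<open>m - 1\<close> and as left end of pair \<open>m\<close>. That leaves two indices for three
    edges, whose indices differ because \<open>dual_ends\<close> is injective on the weak dual
    edges.\<close>
  have "n e = m \<or> Suc (n e) = m" if "e \<in> {{a, b}, {b, c}, {a, c}}" for e
    using n[OF that] F[OF that] m ws(1) by (auto simp: nth_eq_iff_index_eq)
  moreover have "n e \<noteq> n e'" if "e \<in> {{a, b}, {b, c}, {a, c}}" "e' \<in> {{a, b}, {b, c}, {a, c}}" "e \<noteq> e'" for e e'
    using n[OF that(1)] n[OF that(2)] bij_betw_imp_inj_on[OF ws(2)] X[OF that(1)] X[OF that(2)] that(3)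
    by (metis inj_onD)
  moreover have "{a, b} \<noteq> {b, c}" "{a, b} \<noteq> {a, c}" "{b, c} \<noteq> {a, c}"
    using tri edge_neq by (auto simp: doubleton_eq_iff)
  ultimately show False by (metis Suc_inject insertCI)
qed

end

subsection \<open>Noncrossing vertex orders\<close>

lemma noncrossing_mono: "noncrossing xs E \<Longrightarrow> F \<subseteq> E \<Longrightarrow> noncrossing xs F"
  unfolding noncrossing_def by blast

text \<open>A quadruple that ends in \<open>x\<close> becomes one that starts with \<open>x\<close>,
  and the two crossing edges exchange roles. Thus only the cyclic order of the list matters.\<close>

lemma noncrossing_rotate1:
  assumes "noncrossing (x # xs) E"
  shows "noncrossing (xs @ [x]) E"
  unfolding noncrossing_def
proof (intro allI impI notI, elim conjE)
  fix i j k l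
  assume as: "i < j" "j < k" "k < l" "l < length (xs @ [x])"
    "{(xs @ [x]) ! i, (xs @ [x]) ! k} \<in> E" "{(xs @ [x]) ! j, (xs @ [x]) ! l} \<in> E"
  note nc = assms[unfolded noncrossing_def, rule_format]
  show False
  proof (cases "l = length xs")
    case True
    then show False using nc[of 0 "Suc i" "Suc j" "Suc k"] as by (simp add: nth_append insert_commute)
  next
    case False
    then show False using nc[of "Suc i" "Suc j" "Suc k" "Suc l"] as by (simp add: nth_append)
  qed
qed

lemma noncrossing_rotate: "noncrossing (xs @ ys) E \<Longrightarrow> noncrossing (ys @ xs) E"
proof (induction xs arbitrary: ys)
  case (Cons x xs)
  have "noncrossing (xs @ (ys @ [x])) E" using noncrossing_rotate1[of x "xs @ ys"] Cons.prems by simp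
  then show ?case using Cons.IH[of "ys @ [x]"] by simp
qed simp

text \<open>By \<open>m \<le> Suc q\<close> the prefix and the suffix share at most one position, so
  the ends of an edge of \<open>E\<close> and of an edge of \<open>F\<close> cannot interlace. The
  one shared position is there for gluing at a cut vertex.\<close>

lemma noncrossing_glue:
  assumes dist: "distinct zs" and nc: "noncrossing (take m zs) E" "noncrossing (drop q zs) F"
    and mq: "m \<le> Suc q" and sub: "E \<subseteq> Pow (set (take m zs))" "F \<subseteq> Pow (set (drop q zs))"
  shows "noncrossing zs (E \<union> F)"
  unfolding noncrossing_def
proof (intro allI impI notI, elim conjE)
  fix i j k l
  assume as: "i < j" "j < k" "k < l" "l < length zs"
    and e: "{zs ! i, zs ! k} \<in> E \<union> F" "{zs ! j, zs ! l} \<in> E \<union> F"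
  have E: "x < m \<and> y < m" if "{zs ! x, zs ! y} \<in> E" "x < length zs" "y < length zs" for x y
  proof -
    have "zs ! x \<in> set (take m zs)" "zs ! y \<in> set (take m zs)" using that(1) sub(1) by auto
    then show ?thesis using dist that(2,3) by (auto simp: in_set_conv_nth nth_eq_iff_index_eq)
  qed
  have F: "q \<le> x \<and> q \<le> y" if "{zs ! x, zs ! y} \<in> F" "x < length zs" "y < length zs" for x y
  proof -
    have "zs ! x \<in> set (drop q zs)" "zs ! y \<in> set (drop q zs)" using that(1) sub(2) by auto
    then show ?thesis using dist that(2,3) by (auto simp: in_set_conv_nth nth_eq_iff_index_eq)
  qed
  show False
  proof (cases "{zs ! i, zs ! k} \<in> E")
    case True
    then have "k < m" using E[of i k] as by simp
    then have "{zs ! j, zs ! l} \<in> E" using e(2) F[of j l] as mq by auto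
    moreover from this have "l < m" using E[of j l] as by simp
    ultimately show False using nc(1)[unfolded noncrossing_def, rule_format, of i j k l] True as by simp
  next
    case False
    then have ik: "{zs ! i, zs ! k} \<in> F" using e by blast
    then have i: "q \<le> i" using F[of i k] as by simp
    then have jl: "{zs ! j, zs ! l} \<in> F" using e(2) E[of j l] as mq by auto
    show False
      using nc(2)[unfolded noncrossing_def, rule_format, of "i - q" "j - q" "k - q" "l - q"] ik jl as i
      by (simp add: diff_less_mono)
  qed
qed

section \<open>Cut vertices, ears and spanning cycles\<close>

text \<open>The condition \<open>V1 \<inter> V2 \<subseteq> {x}\<close> treats a disconnected graph
  and a cut vertex alike. A graph that is a single edge is not separable.\<close>

definition separable :: "'a set \<Rightarrow> 'a set set \<Rightarrow> bool" where
  "separable V E \<longleftrightarrow> (\<exists>V1 V2 x. V1 \<union> V2 = V \<and> V1 \<inter> V2 \<subseteq> {x} \<and> V1 \<noteq> V \<and> V2 \<noteq> V \<and>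
     (\<forall>e\<in>E. e \<subseteq> V1 \<or> e \<subseteq> V2))"

lemma separableI:
  assumes "V1 \<union> V2 = V" "V1 \<inter> V2 \<subseteq> {x}" "V1 \<noteq> V" "V2 \<noteq> V" "\<And>e. e \<in> E \<Longrightarrow> e \<subseteq> V1 \<or> e \<subseteq> V2"
  shows "separable V E"
  unfolding separable_def using assms by metis

lemma Union_cycle_edges: "xs \<noteq> [] \<Longrightarrow> \<Union>(cycle_edges xs) = set xs"
  unfolding cycle_edges_def by (subst Union_walk_edges) (cases xs, auto)

text \<open>\<open>c\<close> is a vertex of \<open>C\<close> with a neighbour outside, and
  \<open>R\<close> consists of the vertices reached from \<open>c\<close> by paths that avoid
  \<open>C\<close> after their start. If edges left \<open>R\<close> only towards \<open>c\<close>,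
  then \<open>c\<close> would separate \<open>R\<close> from the rest. An edge leaving
  \<open>R\<close> elsewhere ends in \<open>C\<close>, as otherwise its end would belong to
  \<open>R\<close>.\<close>

lemma ear_exists:
  assumes G: "simple_graph V E" and nonsep: "\<not> separable V E"
    and C: "C \<subseteq> V" "C \<noteq> V" "x \<in> C" "y \<in> C" "x \<noteq> y"
  obtains c d ys where "c \<in> C" "d \<in> C" "c \<noteq> d" "ys \<noteq> []" "distinct ys" "set ys \<inter> C = {}"
    "walk_edges (c # ys @ [d]) \<subseteq> E"
proof -
  have EV: "e \<subseteq> V" "\<exists>s t. e = {s, t} \<and> s \<noteq> t" if "e \<in> E" for e
    using G that by (auto simp: simple_graph_def card_2_iff)
  have "\<exists>e\<in>E. \<not> e \<subseteq> C \<and> \<not> e \<subseteq> V - C"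
    using nonsep[unfolded separable_def, simplified, rule_format, of C "V - C"] C by blast
  then obtain e where e: "e \<in> E" "\<not> e \<subseteq> C" "\<not> e \<subseteq> V - C" by blast
  moreover obtain s t where "e = {s, t}" using EV(2) e by blast
  ultimately obtain c z where cz: "c \<in> C" "z \<in> V" "z \<notin> C" "{c, z} \<in> E"
    using EV(1)[OF e(1)] by (auto simp: insert_commute)
  define R where "R = {z. \<exists>ys. distinct (ys @ [z]) \<and> set (ys @ [z]) \<inter> C = {} \<and> walk_edges (c # ys @ [z]) \<subseteq> E}"
  have step: "w \<in> R" if z: "z \<in> R" and zw: "{z, w} \<in> E" and w: "w \<notin> C" for z w
  proof -
    obtain ys where ys: "distinct (ys @ [z])" "set (ys @ [z]) \<inter> C = {}" "walk_edges (c # ys @ [z]) \<subseteq> E"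
      using z unfolding R_def by blast
    show ?thesis
    proof (cases "w \<in> set (ys @ [z])")
      case True
      then obtain P Q where PQ: "ys @ [z] = P @ w # Q" by (meson split_list)
      then have "walk_edges (c # P @ [w]) \<subseteq> E"
        using ys(3) walk_edges_append[of "c # P" w Q] by simp
      moreover have "distinct (P @ [w])" "set (P @ [w]) \<inter> C = {}" using ys(1,2) unfolding PQ by auto
      ultimately show ?thesis unfolding R_def by blast
    next
      case False
      have "walk_edges (c # (ys @ [z]) @ [w]) \<subseteq> E"
        using ys(3) zw walk_edges_append[of "c # ys" z "[w]"] by simp
      moreover have "distinct ((ys @ [z]) @ [w])" "set ((ys @ [z]) @ [w]) \<inter> C = {}" using ys False w by auto
      ultimately show ?thesis unfolding R_def by blast
    qed
  qed
  have "z \<in> R" unfolding R_def using cz by (intro CollectI exI[of _ "[]"]) auto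
  have RV: "R \<subseteq> V"
  proof
    fix z assume "z \<in> R"
    then obtain ys where "walk_edges (c # ys @ [z]) \<subseteq> E" unfolding R_def by blast
    moreover have "\<Union>(walk_edges (c # ys @ [z])) = set (c # ys @ [z])" by (rule Union_walk_edges) simp
    ultimately show "z \<in> V" using EV(1) by auto
  qed
  have RC: "R \<inter> C = {}" unfolding R_def by auto
  have "\<exists>e\<in>E. \<not> e \<subseteq> insert c R \<and> \<not> e \<subseteq> V - R"
  proof (rule ccontr)
    assume "\<not> (\<exists>e\<in>E. \<not> e \<subseteq> insert c R \<and> \<not> e \<subseteq> V - R)"
    then have "\<And>e. e \<in> E \<Longrightarrow> e \<subseteq> insert c R \<or> e \<subseteq> V - R" by blast
    moreover have "insert c R \<union> (V - R) = V" "insert c R \<inter> (V - R) \<subseteq> {c}" "insert c R \<noteq> V" "V - R \<noteq> V"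
      using C cz RV RC \<open>z \<in> R\<close> by auto
    ultimately have "separable V E" by (intro separableI)
    then show False using nonsep by blast
  qed
  then obtain e where e: "e \<in> E" "\<not> e \<subseteq> insert c R" "\<not> e \<subseteq> V - R" by blast
  obtain u v where uv: "e = {u, v}" using EV(2) e by blast
  have "u \<in> R \<and> v \<notin> R \<and> v \<noteq> c \<or> v \<in> R \<and> u \<notin> R \<and> u \<noteq> c"
    using e(2,3) EV(1)[OF e(1)] unfolding uv by blast
  then obtain s t where st: "s \<in> R" "t \<notin> R" "t \<noteq> c" "{s, t} \<in> E"
    using e(1) uv by (metis insert_commute)
  then have "t \<in> C" using step by blast
  obtain ys where ys: "distinct (ys @ [s])" "set (ys @ [s]) \<inter> C = {}" "walk_edges (c # ys @ [s]) \<subseteq> E"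
    using st(1) unfolding R_def by blast
  have "walk_edges (c # (ys @ [s]) @ [t]) \<subseteq> E"
    using ys(3) st(4) walk_edges_append[of "c # ys" s "[t]"] by simp
  then show thesis using that[of c t "ys @ [s]"] cz \<open>t \<in> C\<close> st ys by auto
qed

text \<open>Take a longest cycle, and an ear from \<open>c\<close> to \<open>d\<close> if it misses
  a vertex. If \<open>c\<close> and \<open>d\<close> are consecutive on the cycle, the ear replaces
  their edge and lengthens the cycle; otherwise the ear and the two sides \<open>A\<close>,
  \<open>B\<close> of the cycle form a theta with three inner vertices.\<close>

lemma spanning_cycle_exists:
  assumes G: "simple_graph V E" and nonsep: "\<not> separable V E" and theta: "theta_free E"
    and edge: "{a, b} \<in> E"
  obtains xs where "distinct xs" "cycle_edges xs \<subseteq> E" "set xs = V"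
proof -
  have EV: "e \<subseteq> V" "card e = 2" if "e \<in> E" for e using G that by (auto simp: simple_graph_def)
  have "finite V" using G by (simp add: simple_graph_def)
  let ?P = "\<lambda>xs. distinct xs \<and> cycle_edges xs \<subseteq> E \<and> 2 \<le> length xs"
  have sub: "set xs \<subseteq> V" if "?P xs" for xs
    using that Union_cycle_edges[of xs] EV(1) by fastforce
  have "a \<noteq> b" using EV(2)[OF edge] by auto
  then have P0: "?P [a, b]" using edge by (auto simp: cycle_edges_def insert_commute)
  have "length xs < Suc (card V)" if "?P xs" for xs
    using sub[OF that] that \<open>finite V\<close> card_mono[of V "set xs"] distinct_card[of xs] by simp
  then obtain xs where xs: "?P xs" and max: "\<And>ys. ?P ys \<Longrightarrow> length ys \<le> length xs"
    using ex_has_greatest_nat[of ?P "[a, b]" length "Suc (card V)"] P0 by blast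
  have "set xs = V"
  proof (rule ccontr)
    assume ne: "set xs \<noteq> V"
    obtain x y zs where xyz: "xs = x # y # zs" using xs by (cases xs; cases "tl xs") auto
    obtain c d ys where ear: "c \<in> set xs" "d \<in> set xs" "c \<noteq> d" "ys \<noteq> []" "distinct ys" "set ys \<inter> set xs = {}"
      "walk_edges (c # ys @ [d]) \<subseteq> E"
      by (rule ear_exists[OF G nonsep sub[OF xs] ne, of x y]) (use xs xyz in auto)
    obtain P Q where PQ: "xs = P @ c # Q" using ear(1) by (meson split_list)
    then have "d \<in> set (Q @ P)" using ear(2,3) by auto
    then obtain A B where AB: "Q @ P = A @ d # B" by (meson split_list)
    have cyc: "cycle_edges (c # A @ d # B) \<subseteq> E"
      using xs cycle_edges_rotate[of P "c # Q"] PQ AB by simp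
    have st: "set xs = set (c # A @ d # B)" "length xs = length (c # A @ d # B)"
      using PQ AB[symmetric] by auto
    have "distinct (c # Q @ P)" using xs unfolding PQ by auto
    then have dist: "distinct (c # A @ d # B)" unfolding AB .
    show False
    proof (cases "A = [] \<or> B = []")
      case True
      then show False
      proof
        assume "A = []"
        have "?P (c # ys @ d # B)"
          using ear dist cyc st unfolding cycle_edges_split by auto
        from max[OF this] show False using st \<open>A = []\<close> ear(4) by (cases ys) auto
      next
        assume "B = []"
        have "?P (c # A @ d # rev ys)"
          using ear dist cyc st unfolding cycle_edges_split by auto
        from max[OF this] show False using st \<open>B = []\<close> ear(4) by (cases ys) auto
      qed
    next
      case False
      then have "A \<noteq> [] \<and> rev B \<noteq> [] \<and> ys \<noteq> [] \<and> distinct (c # d # A @ rev B @ ys)"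
        using ear dist unfolding st by auto
      moreover have "walk_edges (c # A @ [d]) \<union> walk_edges (c # rev B @ [d]) \<union> walk_edges (c # ys @ [d]) \<subseteq> E"
        using cyc ear(7) unfolding cycle_edges_split by blast
      ultimately show False using theta unfolding theta_free_def by blast
    qed
  qed
  then show thesis using that xs by blast
qed

lemma theta_free_mono: "theta_free E \<Longrightarrow> F \<subseteq> E \<Longrightarrow> theta_free F"
  unfolding theta_free_def by (meson order_trans)

text \<open>The topological input appears as two combinatorial hypotheses that pass to subgraphs, so
  the induction on \<open>card V\<close> never has to restrict a drawing. In a nonseparable graph
  with an edge, a spanning cycle is itself the order.\<close>

theorem noncrossing_order_exists:
  assumes "simple_graph V E" "theta_free E"
    and "\<And>xs. distinct xs \<Longrightarrow> cycle_edges xs \<subseteq> E \<Longrightarrow> noncrossing xs E"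
  shows "\<exists>xs. distinct xs \<and> set xs = V \<and> noncrossing xs E"
  using assms
proof (induction "card V" arbitrary: V E rule: less_induct)
  case less
  note G = less.prems(1)
  have fin: "finite V" using G by (simp add: simple_graph_def)
  have EV: "e \<subseteq> V" "card e = 2" if "e \<in> E" for e using G that by (auto simp: simple_graph_def)
  show ?case
  proof (cases "separable V E")
    case True
    then obtain V1 V2 x where V: "V1 \<union> V2 = V" "V1 \<inter> V2 \<subseteq> {x}" "V1 \<noteq> V" "V2 \<noteq> V"
      and E: "\<forall>e\<in>E. e \<subseteq> V1 \<or> e \<subseteq> V2"
      unfolding separable_def by (elim exE conjE)
    have part: "\<exists>xs. distinct xs \<and> set xs = W \<and> noncrossing xs {e \<in> E. e \<subseteq> W}" if W: "W \<subset> V" for W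
    proof (rule less.hyps)
      show "card W < card V" using W fin by (simp add: psubset_card_mono)
      show "simple_graph W {e \<in> E. e \<subseteq> W}"
        using G W finite_subset by (auto simp: simple_graph_def)
      show "theta_free {e \<in> E. e \<subseteq> W}" using less.prems(2) by (rule theta_free_mono) blast
      show "noncrossing xs {e \<in> E. e \<subseteq> W}" if "distinct xs" "cycle_edges xs \<subseteq> {e \<in> E. e \<subseteq> W}" for xs
        by (rule noncrossing_mono[OF less.prems(3)]) (use that in auto)
    qed
    obtain xs where xs: "distinct xs" "set xs = V1" "noncrossing xs {e \<in> E. e \<subseteq> V1}"
      using part[of V1] V by blast
    obtain ys where ys: "distinct ys" "set ys = V2" "noncrossing ys {e \<in> E. e \<subseteq> V2}"
      using part[of V2] V by blast
    have E': "{e \<in> E. e \<subseteq> V1} \<union> {e \<in> E. e \<subseteq> V2} = E" using E by blast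
    show ?thesis
    proof (cases "V1 \<inter> V2 = {}")
      case True
      have "noncrossing (xs @ ys) ({e \<in> E. e \<subseteq> V1} \<union> {e \<in> E. e \<subseteq> V2})"
        using xs ys True by (intro noncrossing_glue[of _ "length xs" _ "length xs"]) auto
      then show ?thesis using xs ys True V E' by (intro exI[of _ "xs @ ys"]) auto
    next
      case False
      then have x: "x \<in> set xs" "x \<in> set ys" "V1 \<inter> V2 = {x}" using V xs ys by auto
      obtain P Q where PQ: "xs = P @ x # Q" using x by (meson split_list)
      obtain P' Q' where PQ': "ys = P' @ x # Q'" using x by (meson split_list)
      \<comment> \<open>Rotation brings \<open>x\<close> to the end of the first order and to the
        front of the second, so that they overlap in just this position.\<close>
      let ?zs = "(Q @ P) @ x # (Q' @ P')"
      have 1: "noncrossing ((Q @ P) @ [x]) {e \<in> E. e \<subseteq> V1}"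
        using xs(3) noncrossing_rotate[of "P @ [x]" Q] unfolding PQ by simp
      have 2: "noncrossing (x # Q' @ P') {e \<in> E. e \<subseteq> V2}"
        using ys(3) noncrossing_rotate[of P' "x # Q'"] unfolding PQ' by simp
      have s: "set (Q @ P) = V1 - {x}" "set (Q' @ P') = V2 - {x}" "distinct (Q @ P)" "distinct (Q' @ P')"
        using xs(1,2) ys(1,2) unfolding PQ PQ' by auto
      have "distinct ?zs" using s x(3) unfolding distinct_append distinct.simps set_simps by auto
      moreover have "noncrossing ?zs ({e \<in> E. e \<subseteq> V1} \<union> {e \<in> E. e \<subseteq> V2})"
      proof (rule noncrossing_glue[of _ "Suc (length (Q @ P))" _ "length (Q @ P)"])
        show "noncrossing (take (Suc (length (Q @ P))) ?zs) {e \<in> E. e \<subseteq> V1}"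
          "noncrossing (drop (length (Q @ P)) ?zs) {e \<in> E. e \<subseteq> V2}" using 1 2 by simp_all
        show "{e \<in> E. e \<subseteq> V1} \<subseteq> Pow (set (take (Suc (length (Q @ P))) ?zs))"
          "{e \<in> E. e \<subseteq> V2} \<subseteq> Pow (set (drop (length (Q @ P)) ?zs))" using s by auto
      qed (fact, simp)
      moreover have "set ?zs = V" using s x(3) V(1) by auto
      ultimately show ?thesis using E' by metis
    qed
  next
    case False
    show ?thesis
    proof (cases "E = {}")
      case True
      obtain xs where "set xs = V" "distinct xs" using finite_distinct_list[OF fin] by blast
      then show ?thesis using True by (intro exI[of _ xs]) (simp add: noncrossing_def)
    next
      case nonempty: False
      then obtain e where "e \<in> E" by blast
      then obtain a b where "{a, b} \<in> E" using EV(2) card_2_iff by metis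
      then obtain xs where "distinct xs" "cycle_edges xs \<subseteq> E" "set xs = V"
        using spanning_cycle_exists[OF G False less.prems(2)] by blast
      then show ?thesis using less.prems(3) by blast
    qed
  qed
qed

subsection \<open>Drawing on a parabola\<close>

text \<open>Puts the vertices in convex position at integer parameters, and turns questions about
  chords into polynomial identities.\<close>

definition parabola :: "real \<Rightarrow> complex" where
  "parabola t = Complex t (t^2)"

lemma parabola_eq_iff [simp]: "parabola s = parabola t \<longleftrightarrow> s = t"
  by (auto simp: parabola_def)

lemma parabola_chord:
  assumes "z \<in> closed_segment (parabola a) (parabola b)" "a < b"
  shows "a \<le> Re z" "Re z \<le> b" "Im z = (a + b) * Re z - a * b"
proof -
  obtain u where u: "0 \<le> u" "u \<le> 1" "z = (1 - u) *\<^sub>R parabola a + u *\<^sub>R parabola b"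
    using assms(1) by (auto simp: in_segment)
  have z: "Re z = a + u * (b - a)" "Im z = a^2 + u * (b^2 - a^2)"
    unfolding u(3) by (simp_all add: parabola_def algebra_simps)
  have "0 \<le> u * (b - a)" "u * (b - a) \<le> 1 * (b - a)"
    using u(1,2) assms(2) by (intro mult_nonneg_nonneg mult_right_mono; simp)+
  then show "a \<le> Re z" "Re z \<le> b" unfolding z(1) by simp_all
  show "Im z = (a + b) * Re z - a * b" unfolding z by (simp add: power2_eq_square algebra_simps)
qed

lemma parabola_chord_above:
  assumes "z \<in> closed_segment (parabola a) (parabola b)" "a < b"
  shows "(Re z)^2 \<le> Im z" "Im z = (Re z)^2 \<Longrightarrow> z = parabola a \<or> z = parabola b"
proof -
  note z = parabola_chord[OF assms]
  have eq: "Im z - (Re z)^2 = (b - Re z) * (Re z - a)"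
    unfolding z(3) by (simp add: power2_eq_square algebra_simps)
  moreover have "0 \<le> (b - Re z) * (Re z - a)" using z by simp
  ultimately show "(Re z)^2 \<le> Im z" by linarith
  show "z = parabola a \<or> z = parabola b" if "Im z = (Re z)^2"
    using eq that by (auto simp: parabola_def complex_eq_iff)
qed

lemma nested_chords_meet:
  assumes z: "z \<in> closed_segment (parabola a) (parabola b)" "z \<in> closed_segment (parabola c) (parabola d)"
    and nest: "a \<le> c" "c < d" "d \<le> b" and ne: "a \<noteq> c \<or> b \<noteq> d"
  shows "\<exists>t\<in>{a, b} \<inter> {c, d}. z = parabola t"
proof -
  have ab: "a < b" using nest by simp
  note zab = parabola_chord[OF z(1) ab] and zcd = parabola_chord[OF z(2) nest(2)]
  \<comment> \<open>The left side is the difference of the heights of the two chords above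
    \<open>Re z\<close>, split into two terms that are nonnegative by nesting.\<close>
  have "(b - d) * (Re z - a) + (d - Re z) * (c - a) = 0"
    using zab(3) zcd(3) by (simp add: algebra_simps)
  moreover have "0 \<le> (b - d) * (Re z - a)" "0 \<le> (d - Re z) * (c - a)" using zab zcd nest by simp_all
  ultimately have "(b - d) * (Re z - a) = 0" "(d - Re z) * (c - a) = 0" by linarith+
  then have *: "b = d \<and> Re z = d \<or> a = c \<and> Re z = a"
    using ne zcd(1) nest by auto
  then have "z = parabola a \<or> z = parabola b"
  proof
    assume "b = d \<and> Re z = d"
    then have "z = parabola b" using zab(3) by (auto simp: parabola_def complex_eq_iff power2_eq_square algebra_simps)
    then show ?thesis ..
  next
    assume "a = c \<and> Re z = a"
    then have "z = parabola a" using zab(3) by (auto simp: parabola_def complex_eq_iff power2_eq_square algebra_simps)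
    then show ?thesis ..
  qed
  then show ?thesis using * ab by (auto simp: parabola_def)
qed

lemma noncrossing_chords_meet:
  assumes z: "z \<in> closed_segment (parabola a) (parabola b)" "z \<in> closed_segment (parabola c) (parabola d)"
    and lt: "a < b" "c < d" and nc: "\<not> (a < c \<and> c < b \<and> b < d)" "\<not> (c < a \<and> a < d \<and> d < b)"
    and ne: "a \<noteq> c \<or> b \<noteq> d"
  shows "\<exists>t\<in>{a, b} \<inter> {c, d}. z = parabola t"
proof -
  note zab = parabola_chord[OF z(1) lt(1)] and zcd = parabola_chord[OF z(2) lt(2)]
  consider "b \<le> c" | "d \<le> a" | "a \<le> c" "d \<le> b" | "c \<le> a" "b \<le> d" using nc by linarith
  then show ?thesis
  proof cases
    case 1
    then have "Re z = b" "b = c" using zab zcd by linarith+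
    then have "z = parabola b" using zab(3) by (auto simp: parabola_def complex_eq_iff power2_eq_square algebra_simps)
    then show ?thesis using \<open>b = c\<close> by auto
  next
    case 2
    then have "Re z = a" "d = a" using zab zcd by linarith+
    then have "z = parabola a" using zab(3) by (auto simp: parabola_def complex_eq_iff power2_eq_square algebra_simps)
    then show ?thesis using \<open>d = a\<close> by auto
  next
    case 3
    then show ?thesis using nested_chords_meet[OF z _ lt(2)] ne by blast
  next
    case 4
    then show ?thesis using nested_chords_meet[OF z(2,1) _ lt(1)] ne by blast
  qed
qed

lemma convex_above_parabola: "convex {z. (Re z)^2 \<le> Im z}"
proof (rule convexI, clarsimp)
  fix x y :: complex and u v :: real
  assume as: "(Re x)^2 \<le> Im x" "(Re y)^2 \<le> Im y" "0 \<le> u" "0 \<le> v" "u + v = 1"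
  have v: "v = 1 - u" using as by simp
  have "u * (Re x)^2 + v * (Re y)^2 - (u * Re x + v * Re y)^2 = u * v * (Re x - Re y)^2"
    unfolding v by (simp add: power2_eq_square algebra_simps)
  moreover have "0 \<le> u * v * (Re x - Re y)^2" using as by simp
  moreover have "u * (Re x)^2 \<le> u * Im x" "v * (Re y)^2 \<le> v * Im y" using as by (simp_all add: mult_left_mono)
  ultimately show "(u * Re x + v * Re y)^2 \<le> u * Im x + v * Im y" by linarith
qed

text \<open>Points straight below \<open>parabola t\<close> lie off the convex region above the
  parabola, hence in the outside of \<open>S\<close>; the sequence \<open>?w\<close> approaches
  \<open>parabola t\<close> through them.\<close>

lemma parabola_in_frontier_outside:
  assumes S: "S \<subseteq> {z. (Re z)^2 \<le> Im z}" and t: "parabola t \<in> S"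
  shows "parabola t \<in> frontier (outside S)"
proof -
  let ?w = "\<lambda>n. Complex t (t^2 - inverse (real (Suc n)))"
  have "?w n \<in> outside S" for n
    using outside_subset_convex[OF convex_above_parabola S] by auto
  moreover have "?w \<longlonglongrightarrow> Complex t (t^2 - 0)"
    by (intro tendsto_intros LIMSEQ_inverse_real_of_nat)
  ultimately have "parabola t \<in> closure (outside S)"
    unfolding closure_sequential parabola_def by (intro exI[of _ ?w]) simp
  moreover have "parabola t \<notin> outside S" using t outside_no_overlap by blast
  ultimately show ?thesis unfolding frontier_def using interior_subset by blast
qed

theorem outerplanar_if_noncrossing:
  assumes G: "simple_graph V E" and xs: "distinct xs" "set xs = V" and nc: "noncrossing xs E"
  shows "outerplanar V E"
proof -
  define pos where "pos = the_inv_into {..<length xs} ((!) xs)"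
  have inj: "inj_on ((!) xs) {..<length xs}" using xs(1) by (simp add: inj_on_nth)
  have pos: "pos (xs ! i) = i" if "i < length xs" for i
    unfolding pos_def using that by (intro the_inv_into_f_f inj) simp
  define q where "q v = parabola (pos v)" for v
  \<comment> \<open>An edge is an unordered pair; \<open>Min\<close> and \<open>Max\<close> of the
    positions choose a direction for its segment.\<close>
  define g where "g e = linepath (parabola (Min (pos ` e))) (parabola (Max (pos ` e)))" for e
  have idx: "\<exists>i<length xs. v = xs ! i" if "v \<in> V" for v using that xs(2) by (metis in_set_conv_nth)
  have edge: "\<exists>i j. i < j \<and> j < length xs \<and> e = {xs ! i, xs ! j} \<and> g e = linepath (parabola i) (parabola j)"
    if e: "e \<in> E" for e
  proof -
    obtain u v where uv: "e = {u, v}" "u \<noteq> v" "u \<in> V" "v \<in> V"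
      using G e by (auto simp: simple_graph_def card_2_iff)
    obtain i j where "i < length xs" "u = xs ! i" "j < length xs" "v = xs ! j" using idx uv by metis
    then obtain i j where ij: "i < j" "j < length xs" "e = {xs ! i, xs ! j}"
      using uv by (metis insert_commute linorder_neqE_nat)
    have "pos ` e = {i, j}" using ij pos by simp
    then show ?thesis using ij unfolding g_def by (intro exI[of _ i] exI[of _ j]) simp
  qed
  have qV: "q (xs ! i) = parabola i" if "i < length xs" for i unfolding q_def using pos that by simp
  have below: "z \<in> {z. (Re z)^2 \<le> Im z}" if "e \<in> E" "z \<in> path_image (g e)" for e z
    using edge[OF that(1)] that(2) parabola_chord_above(1) by fastforce
  have "plane_embedding V E q g"
    unfolding plane_embedding_def
  proof (intro conjI ballI impI)
    show "simple_graph V E" by (rule G)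
    show "inj_on q V" using idx qV by (metis (mono_tags, lifting) inj_onI of_nat_eq_iff parabola_eq_iff)
  next
    fix e assume "e \<in> E"
    then obtain i j where ij: "i < j" "j < length xs" "e = {xs ! i, xs ! j}" "g e = linepath (parabola i) (parabola j)"
      using edge by blast
    show "arc (g e)" using ij by (simp add: arc_linepath)
    show "{pathstart (g e), pathfinish (g e)} = q ` e" using ij qV by simp
    show "path_image (g e) \<inter> q ` V = q ` e"
    proof
      show "path_image (g e) \<inter> q ` V \<subseteq> q ` e"
      proof
        fix z assume z: "z \<in> path_image (g e) \<inter> q ` V"
        then obtain v where "v \<in> V" "z = q v" by blast
        then have "Im z = (Re z)^2" by (simp add: q_def parabola_def)
        then have "z = parabola i \<or> z = parabola j"
          using parabola_chord_above(2)[of z i j] z ij by simp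
        then show "z \<in> q ` e" using ij qV by auto
      qed
      have "e \<subseteq> V" using ij xs(2) by (auto intro: nth_mem)
      moreover have "q ` e \<subseteq> path_image (g e)" using ij qV by auto
      ultimately show "q ` e \<subseteq> path_image (g e) \<inter> q ` V" by blast
    qed
  next
    fix e f assume ef: "e \<in> E" "f \<in> E" "e \<noteq> f"
    obtain i j where ij: "i < j" "j < length xs" "e = {xs ! i, xs ! j}" "g e = linepath (parabola i) (parabola j)"
      using edge ef by blast
    obtain k l where kl: "k < l" "l < length xs" "f = {xs ! k, xs ! l}" "g f = linepath (parabola k) (parabola l)"
      using edge ef by blast
    show "path_image (g e) \<inter> path_image (g f) = q ` (e \<inter> f)"
    proof
      show "path_image (g e) \<inter> path_image (g f) \<subseteq> q ` (e \<inter> f)"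
      proof
        fix z assume z: "z \<in> path_image (g e) \<inter> path_image (g f)"
        have "\<not> (i < k \<and> k < j \<and> j < l)" "\<not> (k < i \<and> i < l \<and> l < j)"
          using nc ef ij kl unfolding noncrossing_def by blast+
        moreover have "i \<noteq> k \<or> j \<noteq> l" using ef ij kl by auto
        ultimately obtain t where "t \<in> {real i, real j} \<inter> {real k, real l}" "z = parabola t"
          using noncrossing_chords_meet[of z i j k l] z ij kl by auto
        then obtain m where m: "m \<in> {i, j} \<inter> {k, l}" "z = parabola (real m)" by auto
        then have "xs ! m \<in> e \<inter> f" "z = q (xs ! m)" using ij kl qV by auto
        then show "z \<in> q ` (e \<inter> f)" by blast
      qed
      have "q ` e \<subseteq> path_image (g e)" "q ` f \<subseteq> path_image (g f)" using ij kl qV by auto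
      then show "q ` (e \<inter> f) \<subseteq> path_image (g e) \<inter> path_image (g f)" by blast
    qed
  qed
  moreover have "q ` V \<subseteq> frontier (outer_face V E q g)"
  proof -
    have "point_set V E q g \<subseteq> {z. (Re z)^2 \<le> Im z}"
      using below by (auto simp: point_set_def q_def parabola_def)
    then show ?thesis
      unfolding outer_face_def by (auto simp: q_def point_set_def intro!: parabola_in_frontier_outside)
  qed
  ultimately show ?thesis unfolding outerplanar_def outerplane_embedding_def by blast
qed

subsection \<open>Proper orientations of triangle strips\<close>

text \<open>The last two arguments are the ends of the active edge. The end dropped by
  \<open>triangle\<close> receives no further edge, so its indegree is final from then on;
  \<open>swap\<close> allows either end to be dropped.\<close>

inductive strip :: "'a set \<Rightarrow> 'a set set \<Rightarrow> 'a \<Rightarrow> 'a \<Rightarrow> bool" where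
  edge: "a \<noteq> b \<Longrightarrow> strip {a, b} {{a, b}} a b"
| swap: "strip V E a b \<Longrightarrow> strip V E b a"
| triangle: "strip V E a b \<Longrightarrow> c \<notin> V \<Longrightarrow> strip (insert c V) (insert {a, c} (insert {b, c} E)) b c"

text \<open>
  In a state \<open>(\<alpha>, A, \<beta>, B)\<close> the vertices \<open>a\<close> and \<open>b\<close> of the active edge have indegrees \<open>\<alpha>\<close> and \<open>\<beta>\<close> so far,
  and \<open>A\<close> and \<open>B\<close> contain the values that they can no longer take in the end. Values below the current
  indegree need not be recorded, since indegrees only grow.
\<close>

definition realizable :: "nat \<Rightarrow> 'a set \<Rightarrow> 'a set set \<Rightarrow> 'a \<Rightarrow> 'a \<Rightarrow> nat \<times> nat set \<times> nat \<times> nat set \<Rightarrow> bool" where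
  "realizable k V E a b = (\<lambda>(\<alpha>, A, \<beta>, B). \<exists>D. orientation E D \<and> (\<forall>v\<in>V. indegree D v \<le> k) \<and>
     (\<forall>u v. {u, v} \<in> E \<longrightarrow> {u, v} \<inter> {a, b} = {} \<longrightarrow> indegree D u \<noteq> indegree D v) \<and>
     indegree D a = \<alpha> \<and> indegree D b = \<beta> \<and>
     (\<forall>u. {u, a} \<in> E \<longrightarrow> u \<noteq> b \<longrightarrow> indegree D u < \<alpha> \<or> indegree D u \<in> A) \<and>
     (\<forall>u. {u, b} \<in> E \<longrightarrow> u \<noteq> a \<longrightarrow> indegree D u < \<beta> \<or> indegree D u \<in> B))"

lemma realizable_swap:
  "realizable k V E b a (\<beta>, B, \<alpha>, A) \<longleftrightarrow> realizable k V E a b (\<alpha>, A, \<beta>, B)"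
  unfolding realizable_def by (auto simp: insert_commute Int_commute)

lemma strip_graph:
  assumes "strip V E a b"
  shows "simple_graph V E" "{a, b} \<in> E" "a \<in> V" "b \<in> V" "a \<noteq> b"
proof -
  have "simple_graph V E \<and> {a, b} \<in> E \<and> a \<in> V \<and> b \<in> V \<and> a \<noteq> b"
    using assms by induction (auto simp: simple_graph_def insert_commute card_insert_if)
  then show "simple_graph V E" "{a, b} \<in> E" "a \<in> V" "b \<in> V" "a \<noteq> b" by blast+
qed

lemma orientation_arcs_in:
  assumes "simple_graph V E" "orientation E D" "(u, v) \<in> D"
  shows "u \<in> V" "v \<in> V" "u \<noteq> v"
proof -
  have "{u, v} \<in> E" using assms(2,3) unfolding orientation_def by blast
  then have "{u, v} \<subseteq> V \<and> card {u, v} = 2" using assms(1) unfolding simple_graph_def by blast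
  then show "u \<in> V" "v \<in> V" "u \<noteq> v" by auto
qed

lemma orientation_finite_preds:
  assumes "simple_graph V E" "orientation E D"
  shows "finite {u. (u, v) \<in> D}"
proof (rule finite_subset)
  show "{u. (u, v) \<in> D} \<subseteq> V" using orientation_arcs_in(1)[OF assms] by blast
  show "finite V" using assms(1) by (simp add: simple_graph_def)
qed

text \<open>
  The vertex \<open>a\<close> is retired with final indegree \<open>\<alpha> + x\<close>: \<open>x\<close> and \<open>y\<close> tell whether the arcs between
  the new vertex and \<open>a\<close>, \<open>b\<close> point away from the new vertex.
\<close>

fun admissible_step :: "nat \<Rightarrow> nat \<times> nat set \<times> nat \<times> nat set \<Rightarrow> nat \<times> nat set \<times> nat \<times> nat set \<Rightarrow> bool" where
  "admissible_step k (\<alpha>, A, \<beta>, B) (\<beta>', B', \<gamma>, C) \<longleftrightarrow>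
     (\<exists>x\<in>{0, 1}. \<exists>y\<in>{0, 1}. \<alpha> + x \<notin> A \<and> \<alpha> + x \<le> k \<and> \<beta>' = \<beta> + y \<and> \<beta>' \<le> k \<and> \<gamma> = 2 - x - y \<and>
        (\<forall>m\<in>insert (\<alpha> + x) B. m < \<beta>' \<or> m \<in> B') \<and> (\<alpha> + x < \<gamma> \<or> \<alpha> + x \<in> C))"

text \<open>Only \<open>a\<close>, \<open>b\<close> and \<open>c\<close> change their indegrees. The
  edges newly subject to properness are those at \<open>a\<close> that avoid \<open>b\<close> and
  \<open>c\<close>: the values at their other ends are below \<open>\<alpha>\<close> or in
  \<open>A\<close>, and \<open>\<alpha> + x \<notin> A\<close>. The conflicts of \<open>a\<close>
  with \<open>b\<close> and \<open>c\<close> are handed on to \<open>B'\<close> and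
  \<open>C\<close>.\<close>

lemma realizable_triangle:
  assumes str: "strip V E a b" and c: "c \<notin> V" and k: "2 \<le> k"
    and real: "realizable k V E a b (\<alpha>, A, \<beta>, B)"
    and step: "admissible_step k (\<alpha>, A, \<beta>, B) (\<beta>', B', \<gamma>, C)"
  shows "realizable k (insert c V) (insert {a, c} (insert {b, c} E)) b c (\<beta>', B', \<gamma>, C)"
proof -
  note G = strip_graph[OF str]
  obtain x y :: nat where x01: "x = 0 \<or> x = 1" "y = 0 \<or> y = 1" and fin: "\<alpha> + x \<notin> A" "\<alpha> + x \<le> k" "\<beta>' \<le> k"
    and \<beta>': "\<beta>' = \<beta> + y" and \<gamma>: "\<gamma> = 2 - x - y"
    and B': "\<And>m. m \<in> insert (\<alpha> + x) B \<Longrightarrow> m < \<beta>' \<or> m \<in> B'" and C: "\<alpha> + x < \<gamma> \<or> \<alpha> + x \<in> C"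
    using step unfolding admissible_step.simps by blast
  obtain D where D: "orientation E D" "\<And>v. v \<in> V \<Longrightarrow> indegree D v \<le> k"
    and pr: "\<And>u v. {u, v} \<in> E \<Longrightarrow> {u, v} \<inter> {a, b} = {} \<Longrightarrow> indegree D u \<noteq> indegree D v"
    and ab: "indegree D a = \<alpha>" "indegree D b = \<beta>"
    and na: "\<And>u. {u, a} \<in> E \<Longrightarrow> u \<noteq> b \<Longrightarrow> indegree D u < \<alpha> \<or> indegree D u \<in> A"
    and nb: "\<And>u. {u, b} \<in> E \<Longrightarrow> u \<noteq> a \<Longrightarrow> indegree D u < \<beta> \<or> indegree D u \<in> B"
    using real unfolding realizable_def by auto
  define D' where "D' = D \<union> {if x = 1 then (c, a) else (a, c), if y = 1 then (c, b) else (b, c)}"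
  note inV = orientation_arcs_in[OF G(1) D(1)] and fp = orientation_finite_preds[OF G(1) D(1)]
  have EV: "e \<subseteq> V" if "e \<in> E" for e using G(1) that by (auto simp: simple_graph_def)
  have cab: "c \<noteq> a" "c \<noteq> b" using G c by auto
  have preds: "{u. (u, a) \<in> D'} = {u. (u, a) \<in> D} \<union> (if x = 1 then {c} else {})"
      "{u. (u, b) \<in> D'} = {u. (u, b) \<in> D} \<union> (if y = 1 then {c} else {})"
      "{u. (u, c) \<in> D'} = (if x = 1 then {} else {a}) \<union> (if y = 1 then {} else {b})"
      "\<And>v. v \<noteq> a \<Longrightarrow> v \<noteq> b \<Longrightarrow> v \<noteq> c \<Longrightarrow> {u. (u, v) \<in> D'} = {u. (u, v) \<in> D}"
    using G cab c inV unfolding D'_def by (auto split: if_splits)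
  have cD: "(c, v) \<notin> D" for v using inV c by blast
  have ind: "indegree D' a = \<alpha> + x" "indegree D' b = \<beta>'" "indegree D' c = \<gamma>"
    using x01 G(5) ab[unfolded indegree_def] \<beta>' \<gamma> cD fp unfolding indegree_def preds by auto
  have ind': "indegree D' v = indegree D v" if "v \<noteq> a" "v \<noteq> b" "v \<noteq> c" for v
    unfolding indegree_def preds(4)[OF that] ..
  have ori: "orientation (insert {a, c} (insert {b, c} E)) D'"
  proof -
    have 1: "{u, v} \<in> insert {a, c} (insert {b, c} E)" if "(u, v) \<in> D'" for u v
      using that D(1) unfolding D'_def orientation_def by (auto split: if_splits simp: insert_commute)
    have 2: "((u, v) \<in> D') = ((v, u) \<notin> D')" if "{u, v} \<in> insert {a, c} (insert {b, c} E)" for u v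
    proof (cases "{u, v} \<in> E")
      case True
      then have "u \<noteq> c" "v \<noteq> c" using EV c by auto
      then show ?thesis using D(1) True unfolding D'_def orientation_def by auto
    next
      case False
      then show ?thesis using that cab c G inV unfolding D'_def by (auto simp: doubleton_eq_iff)
    qed
    show ?thesis unfolding orientation_def using 1 2 by blast
  qed
  have bound: "indegree D' v \<le> k" if "v \<in> insert c V" for v
    using that D(2)[of v] ind ind'[of v] fin k \<beta>' \<gamma> by (cases "v = a \<or> v = b \<or> v = c") auto
  have pr': "indegree D' u \<noteq> indegree D' v"
    if e: "{u, v} \<in> insert {a, c} (insert {b, c} E)" "{u, v} \<inter> {b, c} = {}" for u v
  proof -
    have E: "{u, v} \<in> E" and ne: "u \<noteq> b" "u \<noteq> c" "v \<noteq> b" "v \<noteq> c" using e by (auto simp: doubleton_eq_iff)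
    have uv: "u \<noteq> v" using G(1) E by (auto simp: simple_graph_def)
    consider "u = a" | "v = a" | "u \<noteq> a" "v \<noteq> a" by blast
    then show ?thesis
    proof cases
      case 1
      then have "indegree D v < \<alpha> \<or> indegree D v \<in> A" using na[of v] E ne by (auto simp: insert_commute)
      then show ?thesis using 1 ind(1) ind'[of v] uv ne fin(1) by auto
    next
      case 2
      then have "indegree D u < \<alpha> \<or> indegree D u \<in> A" using na[of u] E ne by (auto simp: insert_commute)
      then show ?thesis using 2 ind(1) ind'[of u] uv ne fin(1) by auto
    next
      case 3
      then show ?thesis using pr[OF E] ind'[of u] ind'[of v] ne by auto
    qed
  qed
  have nb': "indegree D' u < \<beta>' \<or> indegree D' u \<in> B'"
    if e: "{u, b} \<in> insert {a, c} (insert {b, c} E)" "u \<noteq> c" for u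
  proof -
    have E: "{u, b} \<in> E" using e cab G(5) by (auto simp: doubleton_eq_iff)
    then have "u \<noteq> b" using G(1) by (auto simp: simple_graph_def)
    show ?thesis
    proof (cases "u = a")
      case True
      then show ?thesis using B' ind by auto
    next
      case False
      then have "indegree D u < \<beta> \<or> indegree D u \<in> B" using nb E by blast
      then show ?thesis using B' \<beta>' ind'[OF False \<open>u \<noteq> b\<close> e(2)] by auto
    qed
  qed
  have nc': "indegree D' u < \<gamma> \<or> indegree D' u \<in> C"
    if e: "{u, c} \<in> insert {a, c} (insert {b, c} E)" "u \<noteq> b" for u
  proof -
    have "u = a" using e cab EV[of "{u, c}"] c by (auto simp: doubleton_eq_iff)
    then show ?thesis using C ind by auto
  qed
  show ?thesis unfolding realizable_def split_conv
    using ori bound pr' ind nb' nc' by (intro exI[of _ D'] conjI) blast+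
qed

text \<open>
  No single state suffices, because the orientation has to depend on which end is retired next.
  These families, found with a SAT solver, are closed under both choices: every state of the next
  family arises from some state of the present one.
\<close>

definition strip_family :: "nat \<Rightarrow> (nat \<times> nat set \<times> nat \<times> nat set) set" where
  "strip_family i =
    (if i = 0 then {(0, {4}, 1, {3,4}), (1, {4}, 0, {3,4})}
     else if i = 1 then {(1, {1}, 3, {3}), (1, {2}, 3, {}), (1, {3}, 2, {2,3,5}), (2, {}, 2, {3,5}), (2, {3}, 1, {2,3})}
     else if i = 2 then {(0, {2}, 4, {5}), (0, {3}, 3, {3,5}), (1, {1}, 3, {3,5}), (1, {3}, 2, {2,3,5}), (2, {}, 2, {2,3,5})}
     else if i = 3 then {(1, {3}, 0, {1,2,3,4,5}), (2, {}, 0, {1,2,3,4,5})}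
     else {(1, {2}, 0, {1,2,3,4}), (2, {2}, 0, {1,2,3,4,5}), (2, {3}, 1, {3,4})})"

fun swap_state :: "nat \<times> nat set \<times> nat \<times> nat set \<Rightarrow> nat \<times> nat set \<times> nat \<times> nat set" where
  "swap_state (\<alpha>, A, \<beta>, B) = (\<beta>, B, \<alpha>, A)"

text \<open>A state of a family lists the newer end first, whereas a step puts the new vertex
  second; hence \<open>swap_state t\<close>. Here the newer end is retired, in
  \<open>strip_family_step_swapped\<close> the older one.\<close>

lemma strip_family_step:
  "\<exists>j. \<forall>t\<in>strip_family j. \<exists>s\<in>strip_family i. admissible_step 5 s (swap_state t)"
proof -
  \<comment> \<open>The target index is the transition of an automaton whose states are the five
    families; every index from 4 on denotes the last family.\<close>
  have "\<forall>t\<in>strip_family (if i = 0 then 4 else if i = 1 \<or> i = 2 then 2 else 3).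
      \<exists>s\<in>strip_family i. admissible_step 5 s (swap_state t)"
    by (simp add: strip_family_def)
  then show ?thesis ..
qed

lemma strip_family_step_swapped:
  "\<exists>j. \<forall>t\<in>strip_family j. \<exists>s\<in>strip_family i. admissible_step 5 (swap_state s) (swap_state t)"
proof -
  have "\<forall>t\<in>strip_family (if i = 0 then 4 else if i = 2 then 0 else 1).
      \<exists>s\<in>strip_family i. admissible_step 5 (swap_state s) (swap_state t)"
    by (simp add: strip_family_def)
  then show ?thesis ..
qed

lemma realizable_swap_state: "realizable k V E b a (swap_state s) \<longleftrightarrow> realizable k V E a b s"
  by (cases s) (simp add: realizable_swap)

text \<open>The disjunction absorbs \<open>swap\<close>: it is left open which end the family lists
  first. In the triangle case the two alternatives correspond to retiring the end listed first or
  the other one.\<close>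

lemma strip_realizes_family:
  assumes "strip V E a b"
  shows "\<exists>i. (\<forall>s\<in>strip_family i. realizable 5 V E a b s) \<or> (\<forall>s\<in>strip_family i. realizable 5 V E b a s)"
  using assms
proof induction
  case (edge a b)
  \<comment> \<open>Neither end has a further neighbour, so the conditions on the two sets are
    vacuous; the two states of the family are the two directions of the edge.\<close>
  have "realizable 5 {a, b} {{a, b}} a b (0, {4}, 1, {3, 4})"
    unfolding realizable_def split_conv
    using edge by (intro exI[of _ "{(a, b)}"]) (auto simp: orientation_def indegree_def doubleton_eq_iff)
  moreover have "realizable 5 {a, b} {{a, b}} a b (1, {4}, 0, {3, 4})"
    unfolding realizable_def split_conv
    using edge by (intro exI[of _ "{(b, a)}"]) (auto simp: orientation_def indegree_def doubleton_eq_iff)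
  ultimately show ?case by (intro exI[of _ 0]) (auto simp: strip_family_def)
next
  case (swap V E a b)
  then show ?case by blast
next
  case (triangle V E a b c)
  have step: "realizable 5 (insert c V) (insert {a, c} (insert {b, c} E)) b c (swap_state t)"
    if "realizable 5 V E a b s" "admissible_step 5 s (swap_state t)" for s t
  proof -
    obtain \<alpha> A \<beta> B \<beta>' B' \<gamma> C where "s = (\<alpha>, A, \<beta>, B)" "swap_state t = (\<beta>', B', \<gamma>, C)"
      by (metis prod_cases4)
    then show ?thesis using realizable_triangle[OF triangle.hyps(1,2), of 5 \<alpha> A \<beta> B \<beta>' B' \<gamma> C] that by (simp del: admissible_step.simps)
  qed
  from triangle.IH obtain i where "(\<forall>s\<in>strip_family i. realizable 5 V E a b s) \<or>
    (\<forall>s\<in>strip_family i. realizable 5 V E a b (swap_state s))"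
    by (auto simp: realizable_swap_state)
  then show ?case
  proof
    assume *: "\<forall>s\<in>strip_family i. realizable 5 V E a b s"
    obtain j where "\<forall>t\<in>strip_family j. \<exists>s\<in>strip_family i. admissible_step 5 s (swap_state t)"
      using strip_family_step by blast
    then show ?thesis using * step realizable_swap_state by metis
  next
    assume *: "\<forall>s\<in>strip_family i. realizable 5 V E a b (swap_state s)"
    obtain j where "\<forall>t\<in>strip_family j. \<exists>s\<in>strip_family i. admissible_step 5 (swap_state s) (swap_state t)"
      using strip_family_step_swapped by blast
    then show ?thesis using * step realizable_swap_state by metis
  qed
qed

text \<open>A strip may end after any triangle, so every family must contain a state whose two
  active ends can keep their present values.\<close>

lemma strip_family_final:
  "\<exists>\<alpha> A \<beta> B. (\<alpha>, A, \<beta>, B) \<in> strip_family i \<and> \<alpha> \<notin> A \<and> \<beta> \<notin> B \<and> \<alpha> \<noteq> \<beta>"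
proof -
  have "\<exists>(\<alpha>, A, \<beta>, B) \<in> strip_family i. \<alpha> \<notin> A \<and> \<beta> \<notin> B \<and> \<alpha> \<noteq> \<beta>"
    by (simp add: strip_family_def)
  then show ?thesis by blast
qed

lemma realizable_imp_proper:
  assumes str: "strip V E a b" and real: "realizable k V E a b (\<alpha>, A, \<beta>, B)"
    and fin: "\<alpha> \<notin> A" "\<beta> \<notin> B" "\<alpha> \<noteq> \<beta>"
  shows "\<exists>D. proper_k_orientation V E k D"
proof -
  obtain D where D: "orientation E D" "\<forall>v\<in>V. indegree D v \<le> k"
    and pr: "\<And>u v. {u, v} \<in> E \<Longrightarrow> {u, v} \<inter> {a, b} = {} \<Longrightarrow> indegree D u \<noteq> indegree D v"
    and ab: "indegree D a = \<alpha>" "indegree D b = \<beta>"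
    and na: "\<And>u. {u, a} \<in> E \<Longrightarrow> u \<noteq> b \<Longrightarrow> indegree D u < \<alpha> \<or> indegree D u \<in> A"
    and nb: "\<And>u. {u, b} \<in> E \<Longrightarrow> u \<noteq> a \<Longrightarrow> indegree D u < \<beta> \<or> indegree D u \<in> B"
    using real unfolding realizable_def by auto
  have na': "indegree D u \<noteq> \<alpha>" if "{u, a} \<in> E" for u
    using na[OF that] ab fin by (cases "u = b") auto
  have nb': "indegree D u \<noteq> \<beta>" if "{u, b} \<in> E" for u
    using nb[OF that] ab fin by (cases "u = a") auto
  have "indegree D u \<noteq> indegree D v" if e: "{u, v} \<in> E" for u v
  proof (cases "{u, v} \<inter> {a, b} = {}")
    case True
    then show ?thesis using pr e by blast
  next
    case False
    have "{v, u} \<in> E" using e by (simp add: insert_commute)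
    then show ?thesis using False e na' nb' ab by force
  qed
  then show ?thesis using D unfolding proper_k_orientation_def proper_orientation_def by blast
qed

theorem strip_proper_5_orientation:
  assumes "strip V E a b"
  shows "\<exists>D. proper_k_orientation V E 5 D"
proof -
  obtain i where "(\<forall>s\<in>strip_family i. realizable 5 V E a b s) \<or> (\<forall>s\<in>strip_family i. realizable 5 V E b a s)"
    using strip_realizes_family[OF assms] by blast
  moreover obtain \<alpha> A \<beta> B where "(\<alpha>, A, \<beta>, B) \<in> strip_family i" "\<alpha> \<notin> A" "\<beta> \<notin> B" "\<alpha> \<noteq> \<beta>"
    using strip_family_final by blast
  ultimately show ?thesis
    using realizable_imp_proper[OF assms] realizable_imp_proper[OF strip.swap[OF assms]] by blast
qed

subsection \<open>Maximal noncrossing graphs are triangle strips\<close>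

locale maximal_noncrossing =
  fixes xs :: "'a list" and E :: "'a set set"
  assumes graph: "simple_graph (set xs) E" and dist: "distinct xs" and nc: "noncrossing xs E"
    and max: "\<And>u v. u \<in> set xs \<Longrightarrow> v \<in> set xs \<Longrightarrow> u \<noteq> v \<Longrightarrow> noncrossing xs (insert {u, v} E) \<Longrightarrow> {u, v} \<in> E"
begin

lemma no_crossing:
  "i < j \<Longrightarrow> j < k \<Longrightarrow> k < l \<Longrightarrow> l < length xs \<Longrightarrow> {xs ! i, xs ! k} \<in> E \<Longrightarrow> {xs ! j, xs ! l} \<in> E \<Longrightarrow> False"
  using nc unfolding noncrossing_def by blast

lemma edge_if_uncrossed:
  assumes ij: "i < j" "j < length xs"
    and uncrossed: "\<And>k l. i < k \<Longrightarrow> k < j \<Longrightarrow> l < length xs \<Longrightarrow> l < i \<or> j < l \<Longrightarrow> {xs ! k, xs ! l} \<notin> E"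
  shows "{xs ! i, xs ! j} \<in> E"
proof (rule max)
  have eq: "{xs ! x, xs ! y} = {xs ! i, xs ! j} \<longleftrightarrow> x = i \<and> y = j"
    if "x < y" "y < length xs" for x y
    using that ij dist by (auto simp: doubleton_eq_iff nth_eq_iff_index_eq)
  show "noncrossing xs (insert {xs ! i, xs ! j} E)"
    unfolding noncrossing_def
  proof (intro allI impI notI, elim conjE)
    fix a b c d
    assume as: "a < b" "b < c" "c < d" "d < length xs" "{xs ! a, xs ! c} \<in> insert {xs ! i, xs ! j} E"
      "{xs ! b, xs ! d} \<in> insert {xs ! i, xs ! j} E"
    have ac: "{xs ! a, xs ! c} \<in> E \<or> a = i \<and> c = j" and bd: "{xs ! b, xs ! d} \<in> E \<or> b = i \<and> d = j"
      using as eq[of a c] eq[of b d] by auto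
    show False
      using ac bd no_crossing[OF as(1-4)] uncrossed[of b d] uncrossed[of c a] as by (auto simp: insert_commute)
  qed
qed (use ij dist in \<open>auto simp: nth_eq_iff_index_eq\<close>)

lemma consecutive_edge: "Suc i < length xs \<Longrightarrow> {xs ! i, xs ! Suc i} \<in> E"
  by (rule edge_if_uncrossed) auto

lemma outer_edge: "2 \<le> length xs \<Longrightarrow> {xs ! 0, xs ! (length xs - 1)} \<in> E"
  by (rule edge_if_uncrossed) auto

text \<open>\<open>k\<close> is the last position before \<open>j\<close> adjacent to
  \<open>i\<close>. An edge crossing the chord from \<open>k\<close> to \<open>j\<close> would also
  cross the edge from \<open>i\<close> to \<open>j\<close> or from \<open>i\<close> to
  \<open>k\<close>, or it would end at \<open>i\<close> and contradict the choice of
  \<open>k\<close>.\<close>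

lemma edge_in_triangle:
  assumes ij: "Suc i < j" "j < length xs" "{xs ! i, xs ! j} \<in> E"
  obtains k where "i < k" "k < j" "{xs ! i, xs ! k} \<in> E" "{xs ! k, xs ! j} \<in> E"
proof -
  let ?P = "\<lambda>k. i < k \<and> k < j \<and> {xs ! i, xs ! k} \<in> E"
  have "?P (Suc i)" using consecutive_edge[of i] ij by simp
  then obtain k where k: "?P k" and kmax: "\<And>m. ?P m \<Longrightarrow> m \<le> k"
    using ex_has_greatest_nat[of ?P "Suc i" "\<lambda>m. m" j] by blast
  have "{xs ! k, xs ! j} \<in> E"
  proof (rule edge_if_uncrossed)
    fix m l assume as: "k < m" "m < j" "l < length xs" "l < k \<or> j < l"
    show "{xs ! m, xs ! l} \<notin> E"
    proof
      assume ml: "{xs ! m, xs ! l} \<in> E"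
      then have lm: "{xs ! l, xs ! m} \<in> E" by (simp add: insert_commute)
      consider "l < i" | "l = i" | "i < l" "l < k" | "j < l" using as by linarith
      then show False
      proof cases
        case 1
        then show False using no_crossing[of l i m j] lm ij as k by simp
      next
        case 2
        then show False using kmax[of m] lm as k by auto
      next
        case 3
        then show False using no_crossing[of i l k m] lm ij as k by simp
      next
        case 4
        then show False using no_crossing[of i m j l] ml ij as k by simp
      qed
    qed
  qed (use k ij in auto)
  then show thesis using that k by blast
qed

text \<open>Among the edges of span at least two, take one of least span. If the span exceeded two,
  a side of the triangle under it would have smaller span, still at least two. The middle vertex is
  an ear of the polygon, at which the strip will end.\<close>

lemma short_chord_exists:
  assumes "3 \<le> length xs"
  obtains i where "Suc (Suc i) < length xs" "{xs ! i, xs ! Suc (Suc i)} \<in> E"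
proof -
  let ?P = "\<lambda>d. \<exists>i. 2 \<le> d \<and> i + d < length xs \<and> {xs ! i, xs ! (i + d)} \<in> E"
  have "?P (length xs - 1)" using outer_edge assms by (intro exI[of _ 0]) auto
  then have "?P (LEAST d. ?P d)" by (rule LeastI)
  then obtain i where i: "2 \<le> (LEAST d. ?P d)" "i + (LEAST d. ?P d) < length xs" "{xs ! i, xs ! (i + (LEAST d. ?P d))} \<in> E"
    by blast
  have "(LEAST d. ?P d) = 2"
  proof (rule ccontr)
    assume "(LEAST d. ?P d) \<noteq> 2"
    then have ij: "Suc (Suc i) < i + (LEAST d. ?P d)" using i by simp
    obtain k where k: "i < k" "k < i + (LEAST d. ?P d)" "{xs ! i, xs ! k} \<in> E" "{xs ! k, xs ! (i + (LEAST d. ?P d))} \<in> E"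
      using edge_in_triangle[of i "i + (LEAST d. ?P d)"] i ij by auto
    show False
    proof (cases "k = Suc i")
      case True
      then have "?P ((LEAST d. ?P d) - 1)"
        using k i ij by (intro exI[of _ k]) auto
      then show False using Least_le[of ?P] i(1) by fastforce
    next
      case False
      then have "?P (k - i)" using k i by (intro exI[of _ i]) auto
      then show False using Least_le[of ?P "k - i"] k by fastforce
    qed
  qed
  then show thesis using that[of i] i by simp
qed

section \<open>The part of the polygon cut off by an edge\<close>

definition part :: "nat \<Rightarrow> nat \<Rightarrow> 'a set" where
  "part i j = (!) xs ` {i..j}"

definition part_edges :: "nat \<Rightarrow> nat \<Rightarrow> 'a set set" where
  "part_edges i j = {e \<in> E. e \<subseteq> part i j}"

lemma part_edges_mono:
  assumes "i' \<le> i" "j \<le> j'"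
  shows "part_edges i j \<subseteq> part_edges i' j'"
proof -
  have "part i j \<subseteq> part i' j'" unfolding part_def by (intro image_mono) (use assms in auto)
  then show ?thesis unfolding part_edges_def by blast
qed

lemma edge_indices:
  assumes "e \<in> part_edges i j" "j < length xs"
  obtains a b where "i \<le> a" "a < b" "b \<le> j" "e = {xs ! a, xs ! b}"
proof -
  have "e \<subseteq> part i j" "card e = 2" using assms graph by (auto simp: part_edges_def simple_graph_def)
  then obtain u v where "e = {u, v}" "u \<noteq> v" "u \<in> part i j" "v \<in> part i j" by (auto simp: card_2_iff)
  then obtain a b where "e = {xs ! a, xs ! b}" "a \<noteq> b" "i \<le> a" "a \<le> j" "i \<le> b" "b \<le> j"
    unfolding part_def by fastforce
  then show thesis using that[of a b] that[of b a] by (metis insert_commute linorder_neqE_nat)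
qed

lemma nth_in_part_iff: "a < length xs \<Longrightarrow> j < length xs \<Longrightarrow> xs ! a \<in> part i j \<longleftrightarrow> i \<le> a \<and> a \<le> j"
  unfolding part_def using dist by (auto simp: nth_eq_iff_index_eq)

lemma pair_in_part_edges_iff:
  assumes "j < length xs" "a < length xs" "b < length xs"
  shows "{xs ! a, xs ! b} \<in> part_edges i j \<longleftrightarrow> {xs ! a, xs ! b} \<in> E \<and> i \<le> a \<and> a \<le> j \<and> i \<le> b \<and> b \<le> j"
  using assms nth_in_part_iff unfolding part_edges_def by auto

text \<open>The edge from \<open>Suc i\<close> to \<open>j\<close> shields \<open>i\<close> from
  every vertex strictly between them, so \<open>Suc i\<close> and \<open>j\<close> are the only
  neighbours of \<open>i\<close> in the part.\<close>

lemma part_edges_left: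
  assumes "Suc i < j" "j < length xs" "{xs ! Suc i, xs ! j} \<in> E" "{xs ! i, xs ! j} \<in> E"
  shows "part_edges i j = insert {xs ! Suc i, xs ! i} (insert {xs ! j, xs ! i} (part_edges (Suc i) j))"
proof (intro equalityI subsetI)
  fix e assume e: "e \<in> part_edges i j"
  then obtain a b where ab: "i \<le> a" "a < b" "b \<le> j" "e = {xs ! a, xs ! b}"
    using edge_indices assms by blast
  have "e \<in> E" using e by (simp add: part_edges_def)
  show "e \<in> insert {xs ! Suc i, xs ! i} (insert {xs ! j, xs ! i} (part_edges (Suc i) j))"
  proof (cases "a = i")
    case True
    then have "b = Suc i \<or> b = j"
      using no_crossing[of i "Suc i" b j] ab assms \<open>e \<in> E\<close> by (cases "b = Suc i"; cases "b = j") auto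
    then show ?thesis using True ab by (auto simp: insert_commute)
  next
    case False
    then show ?thesis using ab \<open>e \<in> E\<close> assms pair_in_part_edges_iff[of j a b "Suc i"] by auto
  qed
next
  fix e assume "e \<in> insert {xs ! Suc i, xs ! i} (insert {xs ! j, xs ! i} (part_edges (Suc i) j))"
  moreover have "{xs ! Suc i, xs ! i} \<in> part_edges i j" "{xs ! j, xs ! i} \<in> part_edges i j"
    using assms consecutive_edge[of i] by (auto simp: pair_in_part_edges_iff insert_commute)
  moreover have "part_edges (Suc i) j \<subseteq> part_edges i j" by (rule part_edges_mono) simp_all
  ultimately show "e \<in> part_edges i j" by blast
qed

lemma part_edges_right:
  assumes "i < j" "Suc j < length xs" "{xs ! i, xs ! j} \<in> E" "{xs ! i, xs ! Suc j} \<in> E"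
  shows "part_edges i (Suc j) = insert {xs ! j, xs ! Suc j} (insert {xs ! i, xs ! Suc j} (part_edges i j))"
proof (intro equalityI subsetI)
  fix e assume e: "e \<in> part_edges i (Suc j)"
  then obtain a b where ab: "i \<le> a" "a < b" "b \<le> Suc j" "e = {xs ! a, xs ! b}"
    using edge_indices assms by blast
  have "e \<in> E" using e by (simp add: part_edges_def)
  show "e \<in> insert {xs ! j, xs ! Suc j} (insert {xs ! i, xs ! Suc j} (part_edges i j))"
  proof (cases "b = Suc j")
    case True
    then have "a = i \<or> a = j"
      using no_crossing[of i a j "Suc j"] ab assms \<open>e \<in> E\<close> by (cases "a = i"; cases "a = j") auto
    then show ?thesis using True ab by auto
  next
    case False
    then show ?thesis using ab \<open>e \<in> E\<close> assms pair_in_part_edges_iff[of j a b i] by auto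
  qed
next
  fix e assume "e \<in> insert {xs ! j, xs ! Suc j} (insert {xs ! i, xs ! Suc j} (part_edges i j))"
  moreover have "{xs ! j, xs ! Suc j} \<in> part_edges i (Suc j)" "{xs ! i, xs ! Suc j} \<in> part_edges i (Suc j)"
    using assms consecutive_edge[of j] by (auto simp: pair_in_part_edges_iff)
  moreover have "part_edges i j \<subseteq> part_edges i (Suc j)" by (rule part_edges_mono) simp_all
  ultimately show "e \<in> part_edges i (Suc j)" by blast
qed

lemma part_insert:
  "i < j \<Longrightarrow> part i j = insert (xs ! i) (part (Suc i) j)"
  "i \<le> Suc j \<Longrightarrow> part i (Suc j) = insert (xs ! Suc j) (part i j)"
proof -
  show "part i j = insert (xs ! i) (part (Suc i) j)" if "i < j"
  proof -
    have "{i..j} = insert i {Suc i..j}" using that by auto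
    then show ?thesis unfolding part_def by (metis image_insert)
  qed
  show "part i (Suc j) = insert (xs ! Suc j) (part i j)" if "i \<le> Suc j"
    unfolding part_def using that by (simp add: atLeastAtMostSuc_conv)
qed

text \<open>\<open>m\<close> is the apex of a triangle on the far side of the edge from
  \<open>i\<close> to \<open>j\<close>; with the apex \<open>k\<close> within the part, this edge is
  in two triangles. If \<open>k\<close> were next to neither \<open>i\<close> nor \<open>j\<close>,
  the other two sides would be in two triangles as well, which is a branching. Hence the part is a
  smaller part plus one end, and that end serves as the new \<open>m\<close>.\<close>

lemma part_strip:
  assumes no_branch: "\<And>a b c. {a, b} \<in> E \<Longrightarrow> {b, c} \<in> E \<Longrightarrow> {a, c} \<in> E \<Longrightarrow>
      \<not> (two_triangles E a b \<and> two_triangles E b c \<and> two_triangles E a c)"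
  shows "i < j \<Longrightarrow> j < length xs \<Longrightarrow> {xs ! i, xs ! j} \<in> E \<Longrightarrow>
    m < length xs \<Longrightarrow> m < i \<or> j < m \<Longrightarrow> {xs ! i, xs ! m} \<in> E \<Longrightarrow> {xs ! j, xs ! m} \<in> E \<Longrightarrow>
    strip (part i j) (part_edges i j) (xs ! i) (xs ! j)"
proof (induction "j - i" arbitrary: i j m rule: less_induct)
  case less
  have neq: "xs ! a \<noteq> xs ! b" if "a \<noteq> b" "a < length xs" "b < length xs" for a b
    using that dist by (simp add: nth_eq_iff_index_eq)
  show ?case
  proof (cases "j = Suc i")
    case True
    have "part_edges i j = {{xs ! i, xs ! j}}"
    proof (intro equalityI subsetI)
      fix e assume "e \<in> part_edges i j"
      then obtain a b where ab: "i \<le> a" "a < b" "b \<le> j" "e = {xs ! a, xs ! b}"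
        using edge_indices less.prems by blast
      then have "a = i" "b = j" using True by auto
      then show "e \<in> {{xs ! i, xs ! j}}" using ab by simp
    qed (use less.prems pair_in_part_edges_iff[of j i j i] in auto)
    moreover have "part i j = {xs ! i, xs ! j}"
    proof -
      have "{i..j} = {i, j}" using True by auto
      then show ?thesis unfolding part_def by simp
    qed
    moreover have "xs ! i \<noteq> xs ! j" using neq less.prems by auto
    ultimately show ?thesis using strip.edge by simp
  next
    case False
    then have ij: "Suc i < j" using less.prems by simp
    then obtain k where k: "i < k" "k < j" "{xs ! i, xs ! k} \<in> E" "{xs ! k, xs ! j} \<in> E"
      using edge_in_triangle less.prems by blast
    have two: "two_triangles E (xs ! a) (xs ! b)"
      if "c \<noteq> d" "c < length xs" "d < length xs" "{xs ! a, xs ! c} \<in> E" "{xs ! b, xs ! c} \<in> E"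
        "{xs ! a, xs ! d} \<in> E" "{xs ! b, xs ! d} \<in> E" for a b c d
      unfolding two_triangles_def using that neq by blast
    have comm: "{x, y} \<in> E" if "{y, x} \<in> E" for x y using that by (simp add: insert_commute)
    have outer: "two_triangles E (xs ! i) (xs ! j)"
      by (rule two[of k m]) (use less.prems k comm in auto)
    have "k = Suc i \<or> Suc k = j"
    proof (rule ccontr)
      assume "\<not> (k = Suc i \<or> Suc k = j)"
      then have far: "Suc i < k" "Suc k < j" using k by auto
      obtain l where l: "i < l" "l < k" "{xs ! i, xs ! l} \<in> E" "{xs ! l, xs ! k} \<in> E"
        using edge_in_triangle[OF far(1)] k less.prems by auto
      obtain r where r: "k < r" "r < j" "{xs ! k, xs ! r} \<in> E" "{xs ! r, xs ! j} \<in> E"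
        using edge_in_triangle[OF far(2)] k less.prems by auto
      have "two_triangles E (xs ! i) (xs ! k)"
        by (rule two[of l j]) (use less.prems k l comm in auto)
      moreover have "two_triangles E (xs ! k) (xs ! j)"
        by (rule two[of r i]) (use less.prems k r comm in auto)
      ultimately show False using no_branch[of "xs ! i" "xs ! k" "xs ! j"] k less.prems outer by blast
    qed
    then show ?thesis
    proof
      assume k': "k = Suc i"
      have "strip (part (Suc i) j) (part_edges (Suc i) j) (xs ! Suc i) (xs ! j)"
        by (rule less.hyps[of j "Suc i" i]) (use less.prems k k' comm in auto)
      moreover have "xs ! i \<notin> part (Suc i) j" using less.prems nth_in_part_iff[of i j "Suc i"] by simp
      ultimately show ?thesis
        using strip.swap[OF strip.triangle] part_insert(1)[of i j] part_edges_left[of i j] less.prems ij k k'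
        by simp
    next
      assume k': "Suc k = j"
      have "strip (part i k) (part_edges i k) (xs ! i) (xs ! k)"
        by (rule less.hyps[of k i j]) (use less.prems k k' comm in auto)
      moreover have "xs ! j \<notin> part i k" using less.prems nth_in_part_iff[of j k i] k k' by simp
      ultimately show ?thesis
        using strip.triangle[OF strip.swap] part_insert(2)[of i k] part_edges_right[of i k] less.prems k k'
        by auto
    qed
  qed
qed

lemma part_all:
  assumes "xs \<noteq> []"
  shows "part 0 (length xs - 1) = set xs" "part_edges 0 (length xs - 1) = E"
proof -
  have "{0..length xs - 1} = {..<length xs}" using assms by (cases xs) auto
  then show all: "part 0 (length xs - 1) = set xs"
    unfolding part_def by (simp add: nth_image lessThan_atLeast0)
  show "part_edges 0 (length xs - 1) = E"
    unfolding part_edges_def all using graph by (auto simp: simple_graph_def)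
qed

end

lemma maximal_noncrossing_rotate:
  assumes "maximal_noncrossing (xs @ ys) E"
  shows "maximal_noncrossing (ys @ xs) E"
proof -
  interpret maximal_noncrossing "xs @ ys" E by fact
  show ?thesis
  proof
    show "simple_graph (set (ys @ xs)) E" using graph by (simp add: Un_commute)
    show "distinct (ys @ xs)" using dist by auto
    show "noncrossing (ys @ xs) E" using nc by (rule noncrossing_rotate)
    show "{u, v} \<in> E" if "u \<in> set (ys @ xs)" "v \<in> set (ys @ xs)" "u \<noteq> v" "noncrossing (ys @ xs) (insert {u, v} E)" for u v
      using max[of u v] that noncrossing_rotate[of ys xs] by auto
  qed
qed

text \<open>\<open>part_strip\<close> needs an edge that already has a triangle on its far side.
  Rotating an ear to the front provides it: the ear is the far apex over its two neighbours, and it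
  is glued on as the last triangle.\<close>

lemma maximal_noncrossing_strip:
  assumes "maximal_noncrossing xs E" and len: "2 \<le> length xs"
    and no_branch: "\<And>a b c. {a, b} \<in> E \<Longrightarrow> {b, c} \<in> E \<Longrightarrow> {a, c} \<in> E \<Longrightarrow>
      \<not> (two_triangles E a b \<and> two_triangles E b c \<and> two_triangles E a c)"
  shows "\<exists>a b. strip (set xs) E a b"
proof (cases "length xs = 2")
  case True
  interpret maximal_noncrossing xs E by fact
  obtain a b where xs: "xs = [a, b]" using True by (metis length_0_conv length_Suc_conv numeral_2_eq_2)
  have "{a, b} \<in> E" using consecutive_edge[of 0] xs by simp
  moreover have "e = {a, b}" if "e \<in> E" for e
    using that graph xs by (auto simp: simple_graph_def card_2_iff)
  ultimately have "E = {{a, b}}" by blast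
  then show ?thesis using strip.edge[of a b] dist xs by auto
next
  case False
  interpret maximal_noncrossing xs E by fact
  obtain i where i: "Suc (Suc i) < length xs" "{xs ! i, xs ! Suc (Suc i)} \<in> E"
    using short_chord_exists False len by auto
  \<comment> \<open>The ear \<open>xs ! Suc i\<close> moves to position 0, its neighbours to
    position 1 and to the last position.\<close>
  let ?ys = "drop (Suc i) xs @ take (Suc i) xs"
  have "maximal_noncrossing ?ys E"
    by (rule maximal_noncrossing_rotate) (use \<open>maximal_noncrossing xs E\<close> in simp)
  then interpret r: maximal_noncrossing ?ys E .
  let ?n = "length xs - 1"
  have len_ys: "length ?ys = length xs" using i by simp
  have nth: "?ys ! 1 = xs ! Suc (Suc i)" "?ys ! ?n = xs ! i" "?ys ! 0 = xs ! Suc i"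
    using i by (auto simp: nth_append)
  have e1n: "{?ys ! 1, ?ys ! ?n} \<in> E" using i nth by (simp add: insert_commute)
  have e0n: "{?ys ! 0, ?ys ! ?n} \<in> E" using r.outer_edge len len_ys by simp
  have e01: "{?ys ! 0, ?ys ! 1} \<in> E" using r.consecutive_edge[of 0] i len_ys by simp
  have "strip (r.part 1 ?n) (r.part_edges 1 ?n) (?ys ! 1) (?ys ! ?n)"
    by (rule r.part_strip[OF no_branch, where m = 0])
      (use e1n e0n e01 len_ys i in \<open>auto simp: insert_commute\<close>)
  moreover have "?ys ! 0 \<notin> r.part 1 ?n" using r.nth_in_part_iff[of 0 ?n 1] len_ys i by simp
  ultimately have "strip (insert (?ys ! 0) (r.part 1 ?n))
      (insert {?ys ! 1, ?ys ! 0} (insert {?ys ! ?n, ?ys ! 0} (r.part_edges 1 ?n))) (?ys ! ?n) (?ys ! 0)"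
    by (rule strip.triangle)
  then have "strip (r.part 0 ?n) (r.part_edges 0 ?n) (?ys ! ?n) (?ys ! 0)"
    using r.part_insert(1)[of 0 ?n] r.part_edges_left[of 0 ?n] i len_ys e1n e0n by simp
  moreover have "r.part 0 ?n = set xs" "r.part_edges 0 ?n = E"
  proof -
    have "?ys \<noteq> []" using i by simp
    from r.part_all[OF this] show "r.part 0 ?n = set xs" "r.part_edges 0 ?n = E"
      unfolding len_ys by (simp_all add: set_append[symmetric] Un_commute del: set_append) (metis append_take_drop_id set_append sup_commute)
  qed
  ultimately show ?thesis by auto
qed

theorem theorem28:
  fixes V :: "'a set" and E :: "'a set set"
    and p :: "'a \<Rightarrow> complex" and \<gamma> :: "'a set \<Rightarrow> real \<Rightarrow> complex"
  assumes "maximal_outerplane V E p \<gamma>"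
    and "weak_dual_is_path V E p \<gamma>"
  shows "proper_orientation_number V E \<le> 13"
proof -
  have emb: "outerplane_embedding V E p \<gamma>"
    and max: "\<And>u v. u \<in> V \<Longrightarrow> v \<in> V \<Longrightarrow> u \<noteq> v \<Longrightarrow> outerplanar V (insert {u, v} E) \<Longrightarrow> {u, v} \<in> E"
    using assms(1) unfolding maximal_outerplane_def maximal_outerplanar_def by blast+
  interpret outerplane V E p \<gamma> by standard (rule emb)
  obtain xs where xs: "distinct xs" "set xs = V" "noncrossing xs E"
    using noncrossing_order_exists[OF graph(1) theta_free cycle_noncrossing] by blast
  have max: "maximal_noncrossing xs E"
  proof
    show "{u, v} \<in> E" if "u \<in> set xs" "v \<in> set xs" "u \<noteq> v" "noncrossing xs (insert {u, v} E)" for u v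
    proof (rule max)
      have "simple_graph V (insert {u, v} E)" using graph(1) that xs(2) by (auto simp: simple_graph_def)
      then show "outerplanar V (insert {u, v} E)" using outerplanar_if_noncrossing xs that(4) by blast
    qed (use that xs in auto)
  qed (use graph xs in auto)
  have "\<exists>D. proper_k_orientation V E 13 D"
  proof (cases "2 \<le> length xs")
    case True
    obtain a b where "strip V E a b"
      using maximal_noncrossing_strip[OF max True] no_branching_triangle[OF assms(2)] xs(2) by blast
    from strip_proper_5_orientation[OF this] obtain D where "proper_k_orientation V E 5 D" ..
    then have "proper_k_orientation V E 13 D" unfolding proper_k_orientation_def by fastforce
    then show ?thesis ..
  next
    case False
    \<comment> \<open>With fewer than two vertices there is no edge from which a strip could start,
      and the empty orientation serves.\<close>
    then have "card V < 2" using xs distinct_card by fastforce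
    have "card e \<le> card V" if "e \<in> E" for e using graph(2,3) that by (simp add: card_mono)
    then have "E = {}" using \<open>card V < 2\<close> graph(4) by fastforce
    then have "proper_k_orientation V E 13 {}"
      unfolding proper_k_orientation_def proper_orientation_def orientation_def indegree_def by simp
    then show ?thesis ..
  qed
  then show ?thesis unfolding proper_orientation_number_def by (rule Least_le)
qed

end
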